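(* Let $E$ be an f-BC, let $e\in E$, let $\widetilde{E}$ be the universal cover of $E$ at $e$, and let $p:\widetilde{E}\rightarrow E$, $\overline{v}\mapsto t(v)$ be the natural covering. For each covering of f-BCs $f:E'\rightarrow E$ and for all $\overline{w}\in\widetilde{E}$, $e'\in E'$ with $p(\overline{w})=f(e')$, there exists a unique covering $\phi:\widetilde{E}\rightarrow E'$ such that $\phi(\overline{w})=e'$ and $p=f\phi$.
   Context: Let $G=\langle g\rangle$ be a fixed infinite cyclic group. A fractional Brauer configuration (f-BC) is a quadruple $E=(E,P,L,d)$, where $E$ is a $G$-set, $P$ and $L$ are two partitions of $E$ (write $P(e)$, $L(e)$ for the classes containing $e\in E$), and $d:E\to\mathbb{Z}_{>0}$ is a function, such that: (f1) $L(e)\subseteq P(e)$ and $P(e)$ is a finite set for each $e\in E$; (f2) if $L(e_1)=L(e_2)$, then $P(g\cdot e_1)=P(g\cdot e_2)$; (f3) if $e_1,e_2$ belong to the same $G$-orbit, then $d(e_1)=d(e_2)$; (f4) $P(e_1)=P(e_2)$ if and only if $P(g^{d(e_1)}\cdot e_1)=P(g^{d(e_2)}\cdot e_2)$; (f5) $L(e_1)=L(e_2)$ if and only if $L(g^{d(e_1)}\cdot e_1)=L(g^{d(e_2)}\cdot e_2)$; (f6) the sequence $L(g^{d(e)-1}\cdot e)\cdots L(g\cdot e)L(e)$ is not a proper subsequence (block of consecutive terms) of $L(g^{d(h)-1}\cdot h)\cdots L(g\cdot h)L(h)$ for all $e,h\in E$. A morphism of f-BCs $f:(E,P,L,d)\to(E',P',L',d')$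 is a $G$-equivariant map with $f(P(e))\subseteq P'(f(e))$, $f(L(e))\subseteq L'(f(e))$ and $d'(f(e))=d(e)$ for all $e\in E$. It is a covering if moreover $f$ induces bijections $P(e)\to P'(f(e))$ and $L(e)\to L'(f(e))$ for all $e\in E$. A walk of $E$ is a sequence $w=(e_n|\delta_n|e_{n-1})\cdots(e_2|\delta_2|e_1)(e_1|\delta_1|e_0)$ with $e_i\in E$, $\delta_i\in\{g,g^{-1},\tau\}$, such that $e_i=g\cdot e_{i-1}$ if $\delta_i=g$, $e_i=g^{-1}\cdot e_{i-1}$ if $\delta_i=g^{-1}$, and $P(e_i)=P(e_{i-1})$ if $\delta_i=\tau$. It is abbreviated $(e_n|\delta_n\cdots\delta_1|e_0)$; its source is $s(w)=e_0$, its terminal $t(w)=e_n$; $(e||e)$ is the walk of length $0$ at $e$. The composition $uv$ is defined by concatenation when $t(v)=s(u)$. The homotopy relation $\sim$ is the smallest equivalence relation on walks such that: (h1) $(e|g^{-1}g|e)\sim(e|gg^{-1}|e)\sim(e|\tau|e)\sim(e||e)$; (h2) $(e_2|\tau|e_1)(e_1|\tau|e_0)\sim(e_2|\tau|e_0)$; (h3) $(g^{d(h)}\cdot h|\tau|g^{d(e)}\cdot e)(g^{d(e)}\cdot e|g^{d(e)}|e)\sim(g^{d(h)}\cdot h|g^{d(h)}|h)(h|\tau|e)$ whenever $P(e)=P(h)$; (h4) $(g\cdot h|\tau|g\cdot e)(g\cdot e|g|e)\sim(g\cdot h|g|h)(h|\tau|e)$ whenever $L(e)=L(h)$; (h5)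 if $w_1\sim w_2$ then $uw_1\sim uw_2$ and $w_1v\sim w_2v$ whenever the compositions make sense. $\overline{w}$ denotes the homotopy class of $w$. The universal cover of $E=(E,P,L,d)$ at $e\in E$ is $\widetilde{E}=(\widetilde{E},\widetilde{P},\widetilde{L},\widetilde{d})$, where $\widetilde{E}=\{\overline{w}\mid w \text{ a walk of } E,\ s(w)=e\}$, $g^n\cdot\overline{w}=\overline{(g^n\cdot t(w)|g^n|t(w))w}$ for $n\in\mathbb{Z}$, $\widetilde{P}(\overline{w})=\{\overline{(h|\tau|t(w))w}\mid h\in P(t(w))\}$, $\widetilde{L}(\overline{w})=\{\overline{(h|\tau|t(w))w}\mid h\in L(t(w))\}$, $\widetilde{d}(\overline{w})=d(t(w))$. It is an f-BC and $p$ is a covering. *)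

theory Defs
  imports
    "HOL-Algebra.Generated_Groups"
    "HOL-Algebra.Group_Action"
    "HOL-Library.Disjoint_Sets"
    "HOL-Library.Sublist"
begin

definition infinite_cyclic_group :: "('g, 'm) monoid_scheme \<Rightarrow> 'g \<Rightarrow> bool" where
  "infinite_cyclic_group G g \<longleftrightarrow>
     group G \<and> g \<in> carrier G \<and> generate G {g} = carrier G \<and> infinite (carrier G)"

section \<open>Fractional Brauer configurations\<close>

text \<open>A quadruple \<open>(E, P, L, d)\<close>: the set \<open>E\<close> is the carrier, \<open>act\<close> is its
  \<open>G\<close>-action, and the partitions \<open>P\<close>, \<open>L\<close> are given as sets of classes.\<close>

record ('g, 'a) fbc_data = "'a partial_object" +
  act :: "'g \<Rightarrow> 'a \<Rightarrow> 'a"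
  Ppart :: "'a set set"
  Lpart :: "'a set set"
  deg :: "'a \<Rightarrow> nat"

definition Pcls :: "('g, 'a) fbc_data \<Rightarrow> 'a \<Rightarrow> 'a set" where
  "Pcls E x = (THE X. X \<in> Ppart E \<and> x \<in> X)"

definition Lcls :: "('g, 'a) fbc_data \<Rightarrow> 'a \<Rightarrow> 'a set" where
  "Lcls E x = (THE X. X \<in> Lpart E \<and> x \<in> X)"

text \<open>The element \<open>g\<^sup>d\<^sup>(\<^sup>x\<^sup>) \<cdot> x\<close>.\<close>

definition nakayama :: "('g, 'm) monoid_scheme \<Rightarrow> 'g \<Rightarrow> ('g, 'a) fbc_data \<Rightarrow> 'a \<Rightarrow> 'a" where
  "nakayama G g E x = act E (g [^]\<^bsub>G\<^esub> deg E x) x"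

text \<open>The sequence \<open>L(g\<^sup>d\<^sup>(\<^sup>x\<^sup>)\<^sup>-\<^sup>1 \<cdot> x) \<dots> L(g \<cdot> x) L(x)\<close>.\<close>

definition Lseq :: "('g, 'm) monoid_scheme \<Rightarrow> 'g \<Rightarrow> ('g, 'a) fbc_data \<Rightarrow> 'a \<Rightarrow> 'a set list" where
  "Lseq G g E x = map (\<lambda>i. Lcls E (act E (g [^]\<^bsub>G\<^esub> i) x)) (rev [0..<deg E x])"

definition fbc :: "('g, 'm) monoid_scheme \<Rightarrow> 'g \<Rightarrow> ('g, 'a) fbc_data \<Rightarrow> bool" where
  "fbc G g E \<longleftrightarrow>
     group_action G (carrier E) (act E) \<and>
     partition_on (carrier E) (Ppart E) \<and>
     partition_on (carrier E) (Lpart E) \<and>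
     (\<forall>x\<in>carrier E. 0 < deg E x) \<and>
     \<comment> \<open>(f1)\<close>
     (\<forall>x\<in>carrier E. Lcls E x \<subseteq> Pcls E x \<and> finite (Pcls E x)) \<and>
     \<comment> \<open>(f2)\<close>
     (\<forall>x\<in>carrier E. \<forall>y\<in>carrier E.
        Lcls E x = Lcls E y \<longrightarrow> Pcls E (act E g x) = Pcls E (act E g y)) \<and>
     \<comment> \<open>(f3)\<close>
     (\<forall>x\<in>carrier E. \<forall>y\<in>orbit G (act E) x. deg E y = deg E x) \<and>
     \<comment> \<open>(f4)\<close>
     (\<forall>x\<in>carrier E. \<forall>y\<in>carrier E.
        Pcls E x = Pcls E y \<longleftrightarrow> Pcls E (nakayama G g E x) = Pcls E (nakayama G g E y)) \<and>
     \<comment> \<open>(f5)\<close>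
     (\<forall>x\<in>carrier E. \<forall>y\<in>carrier E.
        Lcls E x = Lcls E y \<longleftrightarrow> Lcls E (nakayama G g E x) = Lcls E (nakayama G g E y)) \<and>
     \<comment> \<open>(f6); \<open>sublist\<close> is the relation of being a block of consecutive terms\<close>
     (\<forall>x\<in>carrier E. \<forall>y\<in>carrier E. \<not> strict_sublist (Lseq G g E x) (Lseq G g E y))"

text \<open>Maps are taken in the extensional function space, so that equality of morphisms is
  equality as maps on the carrier.\<close>

definition fbc_morphism ::
  "('g, 'm) monoid_scheme \<Rightarrow> 'g \<Rightarrow> ('g, 'a) fbc_data \<Rightarrow> ('g, 'b) fbc_data \<Rightarrow> ('a \<Rightarrow> 'b) \<Rightarrow> bool"
  where
  "fbc_morphism G g E E' f \<longleftrightarrow>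
     fbc G g E \<and> fbc G g E' \<and>
     f \<in> carrier E \<rightarrow>\<^sub>E carrier E' \<and>
     (\<forall>a\<in>carrier G. \<forall>x\<in>carrier E. f (act E a x) = act E' a (f x)) \<and>
     (\<forall>x\<in>carrier E. f ` Pcls E x \<subseteq> Pcls E' (f x) \<and> f ` Lcls E x \<subseteq> Lcls E' (f x) \<and>
        deg E' (f x) = deg E x)"

definition fbc_covering ::
  "('g, 'm) monoid_scheme \<Rightarrow> 'g \<Rightarrow> ('g, 'a) fbc_data \<Rightarrow> ('g, 'b) fbc_data \<Rightarrow> ('a \<Rightarrow> 'b) \<Rightarrow> bool"
  where
  "fbc_covering G g E E' f \<longleftrightarrow>
     fbc_morphism G g E E' f \<and>
     (\<forall>x\<in>carrier E. bij_betw f (Pcls E x) (Pcls E' (f x)) \<and>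
        bij_betw f (Lcls E x) (Lcls E' (f x)))"

section \<open>Walks and homotopy\<close>

text \<open>The letters \<open>g\<close>, \<open>g\<^sup>-\<^sup>1\<close>, \<open>\<tau>\<close>. The walk \<open>(x||x)\<close> is \<open>Triv x\<close>, and
  \<open>Step x \<delta> w\<close> is \<open>(x|\<delta>|t(w)) w\<close>.\<close>

datatype letter = Fwd | Bwd | Tau

datatype 'a walk = Triv 'a | Step 'a letter "'a walk"

primrec source :: "'a walk \<Rightarrow> 'a" where
  "source (Triv x) = x"
| "source (Step x \<delta> w) = source w"

fun terminal :: "'a walk \<Rightarrow> 'a" where
  "terminal (Triv x) = x"
| "terminal (Step x \<delta> w) = x"

primrec walk_comp :: "'a walk \<Rightarrow> 'a walk \<Rightarrow> 'a walk" where
  "walk_comp (Triv x) v = v"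
| "walk_comp (Step x \<delta> u) v = Step x \<delta> (walk_comp u v)"

text \<open>Validity of the one-letter walk \<open>(y|\<delta>|x)\<close>.\<close>

fun valid_step :: "('g, 'm) monoid_scheme \<Rightarrow> 'g \<Rightarrow> ('g, 'a) fbc_data \<Rightarrow> 'a \<Rightarrow> letter \<Rightarrow> 'a \<Rightarrow> bool"
  where
  "valid_step G g E y Fwd x \<longleftrightarrow> y = act E g x"
| "valid_step G g E y Bwd x \<longleftrightarrow> y = act E (inv\<^bsub>G\<^esub> g) x"
| "valid_step G g E y Tau x \<longleftrightarrow> Pcls E y = Pcls E x"

primrec is_walk :: "('g, 'm) monoid_scheme \<Rightarrow> 'g \<Rightarrow> ('g, 'a) fbc_data \<Rightarrow> 'a walk \<Rightarrow> bool" where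
  "is_walk G g E (Triv x) \<longleftrightarrow> x \<in> carrier E"
| "is_walk G g E (Step x \<delta> w) \<longleftrightarrow>
     x \<in> carrier E \<and> valid_step G g E x \<delta> (terminal w) \<and> is_walk G g E w"

primrec fwd_walk :: "'g \<Rightarrow> ('g, 'a) fbc_data \<Rightarrow> nat \<Rightarrow> 'a \<Rightarrow> 'a walk" where
  "fwd_walk g E 0 x = Triv x"
| "fwd_walk g E (Suc n) x = Step (act E g (terminal (fwd_walk g E n x))) Fwd (fwd_walk g E n x)"

primrec bwd_walk ::
  "('g, 'm) monoid_scheme \<Rightarrow> 'g \<Rightarrow> ('g, 'a) fbc_data \<Rightarrow> nat \<Rightarrow> 'a \<Rightarrow> 'a walk" where
  "bwd_walk G g E 0 x = Triv x"
| "bwd_walk G g E (Suc n) x =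
     Step (act E (inv\<^bsub>G\<^esub> g) (terminal (bwd_walk G g E n x))) Bwd (bwd_walk G g E n x)"

text \<open>The walk \<open>(g\<^sup>n \<cdot> x|g\<^sup>n|x)\<close> for an integer \<open>n\<close>.\<close>

definition power_walk ::
  "('g, 'm) monoid_scheme \<Rightarrow> 'g \<Rightarrow> ('g, 'a) fbc_data \<Rightarrow> int \<Rightarrow> 'a \<Rightarrow> 'a walk" where
  "power_walk G g E n x =
     (if 0 \<le> n then fwd_walk g E (nat n) x else bwd_walk G g E (nat (- n)) x)"

definition tau_walk :: "'a \<Rightarrow> 'a \<Rightarrow> 'a walk" where
  "tau_walk y x = Step y Tau (Triv x)"

inductive homotopic ::
  "('g, 'm) monoid_scheme \<Rightarrow> 'g \<Rightarrow> ('g, 'a) fbc_data \<Rightarrow> 'a walk \<Rightarrow> 'a walk \<Rightarrow> bool"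
  for G g E where
  refl: "is_walk G g E w \<Longrightarrow> homotopic G g E w w"
| sym: "homotopic G g E u v \<Longrightarrow> homotopic G g E v u"
| trans: "homotopic G g E u v \<Longrightarrow> homotopic G g E v w \<Longrightarrow> homotopic G g E u w"
| h1_bwd_fwd: "x \<in> carrier E \<Longrightarrow>
    homotopic G g E (Step x Bwd (Step (act E g x) Fwd (Triv x))) (Triv x)"
| h1_fwd_bwd: "x \<in> carrier E \<Longrightarrow>
    homotopic G g E (Step x Fwd (Step (act E (inv\<^bsub>G\<^esub> g) x) Bwd (Triv x))) (Triv x)"
| h1_tau: "x \<in> carrier E \<Longrightarrow> homotopic G g E (tau_walk x x) (Triv x)"
| h2: "x \<in> carrier E \<Longrightarrow> y \<in> carrier E \<Longrightarrow> z \<in> carrier E \<Longrightarrow>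
    Pcls E y = Pcls E x \<Longrightarrow> Pcls E z = Pcls E y \<Longrightarrow>
    homotopic G g E (walk_comp (tau_walk z y) (tau_walk y x)) (tau_walk z x)"
| h3: "x \<in> carrier E \<Longrightarrow> y \<in> carrier E \<Longrightarrow> Pcls E x = Pcls E y \<Longrightarrow>
    homotopic G g E
      (walk_comp (tau_walk (nakayama G g E y) (nakayama G g E x)) (power_walk G g E (int (deg E x)) x))
      (walk_comp (power_walk G g E (int (deg E y)) y) (tau_walk y x))"
| h4: "x \<in> carrier E \<Longrightarrow> y \<in> carrier E \<Longrightarrow> Lcls E x = Lcls E y \<Longrightarrow>
    homotopic G g E
      (walk_comp (tau_walk (act E g y) (act E g x)) (power_walk G g E 1 x))
      (walk_comp (power_walk G g E 1 y) (tau_walk y x))"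
| h5_left: "homotopic G g E v w \<Longrightarrow> is_walk G g E u \<Longrightarrow>
    source u = terminal v \<Longrightarrow> source u = terminal w \<Longrightarrow>
    homotopic G g E (walk_comp u v) (walk_comp u w)"
| h5_right: "homotopic G g E u w \<Longrightarrow> is_walk G g E v \<Longrightarrow>
    source u = terminal v \<Longrightarrow> source w = terminal v \<Longrightarrow>
    homotopic G g E (walk_comp u v) (walk_comp w v)"

definition hclass ::
  "('g, 'm) monoid_scheme \<Rightarrow> 'g \<Rightarrow> ('g, 'a) fbc_data \<Rightarrow> 'a walk \<Rightarrow> 'a walk set" where
  "hclass G g E w = {v. homotopic G g E w v}"

section \<open>The universal cover\<close>

text \<open>Operations on homotopy classes are defined through a chosen representative; they do not
  depend on this choice, since homotopic walks have equal source and terminal and homotopy is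
  compatible with composition.\<close>

definition rep :: "'a walk set \<Rightarrow> 'a walk" where
  "rep W = (SOME w. w \<in> W)"

definition uc_carrier ::
  "('g, 'm) monoid_scheme \<Rightarrow> 'g \<Rightarrow> ('g, 'a) fbc_data \<Rightarrow> 'a \<Rightarrow> 'a walk set set" where
  "uc_carrier G g E e = {hclass G g E w | w. is_walk G g E w \<and> source w = e}"

definition exponent_of :: "('g, 'm) monoid_scheme \<Rightarrow> 'g \<Rightarrow> 'g \<Rightarrow> int" where
  "exponent_of G g a = (THE n. a = g [^]\<^bsub>G\<^esub> n)"

definition uc_act ::
  "('g, 'm) monoid_scheme \<Rightarrow> 'g \<Rightarrow> ('g, 'a) fbc_data \<Rightarrow> 'a \<Rightarrow> 'g \<Rightarrow> 'a walk set \<Rightarrow> 'a walk set"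
  where
  "uc_act G g E e a = (\<lambda>W\<in>uc_carrier G g E e.
     hclass G g E (walk_comp (power_walk G g E (exponent_of G g a) (terminal (rep W))) (rep W)))"

definition uc_Pcls ::
  "('g, 'm) monoid_scheme \<Rightarrow> 'g \<Rightarrow> ('g, 'a) fbc_data \<Rightarrow> 'a walk set \<Rightarrow> 'a walk set set" where
  "uc_Pcls G g E W =
     {hclass G g E (walk_comp (tau_walk h (terminal (rep W))) (rep W)) | h. h \<in> Pcls E (terminal (rep W))}"

definition uc_Lcls ::
  "('g, 'm) monoid_scheme \<Rightarrow> 'g \<Rightarrow> ('g, 'a) fbc_data \<Rightarrow> 'a walk set \<Rightarrow> 'a walk set set" where
  "uc_Lcls G g E W =
     {hclass G g E (walk_comp (tau_walk h (terminal (rep W))) (rep W)) | h. h \<in> Lcls E (terminal (rep W))}"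

definition univ_cover ::
  "('g, 'm) monoid_scheme \<Rightarrow> 'g \<Rightarrow> ('g, 'a) fbc_data \<Rightarrow> 'a \<Rightarrow> ('g, 'a walk set) fbc_data" where
  "univ_cover G g E e =
     \<lparr>carrier = uc_carrier G g E e,
      act = uc_act G g E e,
      Ppart = uc_Pcls G g E ` uc_carrier G g E e,
      Lpart = uc_Lcls G g E ` uc_carrier G g E e,
      deg = (\<lambda>W. deg E (terminal (rep W)))\<rparr>"

definition cover_proj ::
  "('g, 'm) monoid_scheme \<Rightarrow> 'g \<Rightarrow> ('g, 'a) fbc_data \<Rightarrow> 'a \<Rightarrow> 'a walk set \<Rightarrow> 'a" where
  "cover_proj G g E e = (\<lambda>W\<in>carrier (univ_cover G g E e). terminal (rep W))"

end

theory Submission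
  imports (* Defs comes last so that deg is the field of fbc_data, not UnivPoly.deg *)
    "HOL-Algebra.Multiplicative_Group"
    Defs
begin

text \<open>A covering lifts walks uniquely once a starting point is fixed, and the terminal of the lift
  depends only on the homotopy class: (f4) and (f2) upstairs, with uniqueness of lifts of \<open>\<tau>\<close>-steps,
  lift the relations (h3) and (h4). So \<open>W\<close> determines a point \<open>x\<close> over \<open>e\<close>, the start of the lift of
  a representative of \<open>W\<close> that ends in \<open>e'\<close>, and \<open>\<phi>\<close> sends the class of \<open>v\<close> to the terminal of the lift
  of \<open>v\<close> from \<open>x\<close>. Conversely, every morphism over \<open>E\<close> has this form for \<open>x\<close> the image of the class of
  the trivial walk, and lifting along a fixed walk is injective. Coverings being maps between f-BCs,
  one also has to see that the universal cover is one; (f4) and (f5) hold there because of (h3)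
  and because the action of a power of \<open>g\<close> on classes is invertible, (f2) because of (h4), and
  (f6) because the projection maps the sequences of blocks to those of \<open>E\<close>.\<close>

section \<open>Partitions, group actions and sublists\<close>

lemma partition_on_THE_eq:
  assumes "partition_on A P" and "X \<in> P" and "x \<in> X"
  shows "(THE X. X \<in> P \<and> x \<in> X) = X"
proof (rule the_equality)
  show "X \<in> P \<and> x \<in> X" using assms by simp
next
  fix Y assume "Y \<in> P \<and> x \<in> Y"
  then show "Y = X"
    using partition_onD2[OF assms(1)] assms(2,3) by (auto simp: disjoint_def)
qed

lemma partition_on_THE_mem_iff:
  assumes P: "partition_on A P" and "x \<in> A"
  shows "y \<in> (THE X. X \<in> P \<and> x \<in> X) \<longleftrightarrow>
    y \<in> A \<and> (THE X. X \<in> P \<and> y \<in> X) = (THE X. X \<in> P \<and> x \<in> X)"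
proof -
  obtain X where X: "X \<in> P" "x \<in> X" using partition_onD1[OF P] assms(2) by blast
  note eqX = partition_on_THE_eq[OF P X]
  show ?thesis
  proof
    assume "y \<in> (THE X. X \<in> P \<and> x \<in> X)"
    then have "y \<in> X" by (simp add: eqX)
    then show "y \<in> A \<and> (THE X. X \<in> P \<and> y \<in> X) = (THE X. X \<in> P \<and> x \<in> X)"
      using partition_onD1[OF P] X(1) partition_on_THE_eq[OF P X(1)] eqX by auto
  next
    assume y: "y \<in> A \<and> (THE X. X \<in> P \<and> y \<in> X) = (THE X. X \<in> P \<and> x \<in> X)"
    then obtain Y where Y: "Y \<in> P" "y \<in> Y" using partition_onD1[OF P] by blast
    then show "y \<in> (THE X. X \<in> P \<and> x \<in> X)" using partition_on_THE_eq[OF P Y] y by simp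
  qed
qed

text \<open>If two blocks share a point \<open>x\<close>, both equal \<open>c x\<close>; hence
  distinct blocks are disjoint.\<close>

lemma partition_on_image:
  assumes "\<And>x. x \<in> A \<Longrightarrow> x \<in> c x" and "\<And>x. x \<in> A \<Longrightarrow> c x \<subseteq> A"
    and "\<And>x y. x \<in> A \<Longrightarrow> y \<in> c x \<Longrightarrow> c y = c x"
  shows "partition_on A (c ` A)"
proof (rule partition_onI)
  show "\<Union> (c ` A) = A" using assms(1,2) by blast
  show "disjnt X Y" if "X \<in> c ` A" "Y \<in> c ` A" "X \<noteq> Y" for X Y
    using that by (auto simp: disjnt_iff) (metis assms(3))+
  show "{} \<notin> c ` A" using assms(1) by blast
qed

text \<open>\<open>group_action\<close> means a homomorphism into \<open>BijGroup\<close>, whose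
  elements are extensional bijections. Pointwise laws give this because the inverse of
  \<open>a\<close> acts as the inverse map.\<close>

lemma group_actionI:
  assumes "group G"
    and ext: "\<And>a. a \<in> carrier G \<Longrightarrow> \<phi> a \<in> extensional A"
    and closed: "\<And>a x. a \<in> carrier G \<Longrightarrow> x \<in> A \<Longrightarrow> \<phi> a x \<in> A"
    and one: "\<And>x. x \<in> A \<Longrightarrow> \<phi> \<one>\<^bsub>G\<^esub> x = x"
    and mult: "\<And>a b x. a \<in> carrier G \<Longrightarrow> b \<in> carrier G \<Longrightarrow> x \<in> A \<Longrightarrow>
                 \<phi> (a \<otimes>\<^bsub>G\<^esub> b) x = \<phi> a (\<phi> b x)"
  shows "group_action G A \<phi>"
proof -
  interpret group G by fact
  have cancel: "\<phi> (inv\<^bsub>G\<^esub> a) (\<phi> a x) = x" "\<phi> a (\<phi> (inv\<^bsub>G\<^esub> a) x) = x"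
    if "a \<in> carrier G" "x \<in> A" for a x
    using mult[of "inv\<^bsub>G\<^esub> a" a x] mult[of a "inv\<^bsub>G\<^esub> a" x] one that by simp_all
  have Bij: "\<phi> a \<in> Bij A" if "a \<in> carrier G" for a
  proof -
    have "bij_betw (\<phi> a) A A"
      by (rule bij_betwI[where g = "\<phi> (inv\<^bsub>G\<^esub> a)"]) (use that closed cancel in auto)
    then show ?thesis using ext[OF that] by (simp add: Bij_def)
  qed
  have "\<phi> \<in> hom G (BijGroup A)"
  proof (rule homI)
    show "\<phi> a \<in> carrier (BijGroup A)" if "a \<in> carrier G" for a
      using Bij[OF that] by (simp add: BijGroup_def)
    show "\<phi> (a \<otimes>\<^bsub>G\<^esub> b) = \<phi> a \<otimes>\<^bsub>BijGroup A\<^esub> \<phi> b" if "a \<in> carrier G" "b \<in> carrier G" for a b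
    proof -
      have "\<phi> (a \<otimes>\<^bsub>G\<^esub> b) = compose A (\<phi> a) (\<phi> b)"
        by (rule extensionalityI[of _ A]) (use that ext mult in \<open>auto simp: compose_eq\<close>)
      then show ?thesis using that Bij by (simp add: BijGroup_def)
    qed
  qed
  then show ?thesis
    by (simp add: group_action_def group_hom_def group_hom_axioms_def group_BijGroup is_group)
qed

text \<open>A proper block is strictly shorter and \<open>map\<close> preserves lengths, so
  properness survives even if \<open>f\<close> identifies entries.\<close>

lemma map_mono_strict_sublist:
  assumes "strict_sublist xs ys"
  shows "strict_sublist (map f xs) (map f ys)"
proof -
  have sub: "sublist xs ys" and "xs \<noteq> ys" using assms by (auto simp: strict_sublist_def)
  then have "length xs \<noteq> length ys" by (auto simp: sublist_def)
  then have "map f xs \<noteq> map f ys" using map_eq_imp_length_eq by blast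
  then show ?thesis using map_mono_sublist[OF sub] by (simp add: strict_sublist_def)
qed

section \<open>Walks and their homotopies\<close>

lemma source_walk_comp [simp]: "source (walk_comp u v) = source v"
  by (induction u) auto

lemma terminal_walk_comp: "source u = terminal v \<Longrightarrow> terminal (walk_comp u v) = terminal u"
  by (cases u) auto

lemma is_walk_walk_comp:
  "is_walk G g E u \<Longrightarrow> is_walk G g E v \<Longrightarrow> source u = terminal v \<Longrightarrow> is_walk G g E (walk_comp u v)"
  by (induction u) (auto simp: terminal_walk_comp)

lemma walk_comp_assoc: "walk_comp (walk_comp u v) w = walk_comp u (walk_comp v w)"
  by (induction u) auto

lemma terminal_in_carrier: "is_walk G g E w \<Longrightarrow> terminal w \<in> carrier E"
  by (cases w) auto

lemma source_fwd_walk [simp]: "source (fwd_walk g E n x) = x"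
  by (induction n) auto

lemma source_bwd_walk [simp]: "source (bwd_walk G g E n x) = x"
  by (induction n) auto

lemma source_power_walk [simp]: "source (power_walk G g E n x) = x"
  by (simp add: power_walk_def)

section \<open>Consequences of the axioms, and power walks\<close>

locale frac_brauer =
  fixes G :: "('g, 'm) monoid_scheme" and g :: 'g and E :: "('g, 'a) fbc_data"
  assumes cyclic: "infinite_cyclic_group G g" and fbc: "fbc G g E"
begin

sublocale group G
  using cyclic by (simp add: infinite_cyclic_group_def)

sublocale action: group_action G "carrier E" "act E"
  using fbc by (simp add: fbc_def)

lemma g_closed [simp]: "g \<in> carrier G"
  using cyclic by (simp add: infinite_cyclic_group_def)

lemma act_closed [simp]: "a \<in> carrier G \<Longrightarrow> x \<in> carrier E \<Longrightarrow> act E a x \<in> carrier E"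
  using action.element_image by blast

lemma act_mult:
  "a \<in> carrier G \<Longrightarrow> b \<in> carrier G \<Longrightarrow> x \<in> carrier E \<Longrightarrow> act E (a \<otimes>\<^bsub>G\<^esub> b) x = act E a (act E b x)"
  by (rule action.composition_rule)

lemma act_one [simp]: "x \<in> carrier E \<Longrightarrow> act E \<one>\<^bsub>G\<^esub> x = x"
  using action.id_eq_one by (metis restrict_apply')

lemma act_inv_cancel [simp]:
  assumes "a \<in> carrier G" and "x \<in> carrier E"
  shows "act E (inv\<^bsub>G\<^esub> a) (act E a x) = x" and "act E a (act E (inv\<^bsub>G\<^esub> a) x) = x"
  using act_mult[of "inv\<^bsub>G\<^esub> a" a x] act_mult[of a "inv\<^bsub>G\<^esub> a" x] assms by simp_all

lemma carrier_power: "a \<in> carrier G \<Longrightarrow> \<exists>n::int. a = g [^]\<^bsub>G\<^esub> n"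
  using cyclic generate_pow[OF g_closed] by (auto simp: infinite_cyclic_group_def)

lemma exponent_of_power [simp]: "exponent_of G g (g [^]\<^bsub>G\<^esub> (n::int)) = n"
proof -
  \<comment> \<open>The order is the cardinality of the generated subgroup, and \<open>card\<close>
    of an infinite set is 0. Powers of \<open>g\<close> with distinct integer exponents are
    therefore distinct.\<close>
  have "ord g = 0"
    using generate_pow_card[OF g_closed] cyclic by (simp add: infinite_cyclic_group_def)
  then show ?thesis
    unfolding exponent_of_def by (intro the_equality) (auto simp: int_pow_eq)
qed

lemma Ppart: "partition_on (carrier E) (Ppart E)"
  and Lpart: "partition_on (carrier E) (Lpart E)"
  using fbc by (simp_all add: fbc_def)

lemma Pcls_mem_iff: "x \<in> carrier E \<Longrightarrow> y \<in> Pcls E x \<longleftrightarrow> y \<in> carrier E \<and> Pcls E y = Pcls E x"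
  using partition_on_THE_mem_iff[OF Ppart] by (simp add: Pcls_def)

lemma Lcls_mem_iff: "x \<in> carrier E \<Longrightarrow> y \<in> Lcls E x \<longleftrightarrow> y \<in> carrier E \<and> Lcls E y = Lcls E x"
  using partition_on_THE_mem_iff[OF Lpart] by (simp add: Lcls_def)

lemma fbc_conditions:
  shows "\<forall>x\<in>carrier E. 0 < deg E x"
    and "\<forall>x\<in>carrier E. Lcls E x \<subseteq> Pcls E x \<and> finite (Pcls E x)"
    and "\<forall>x\<in>carrier E. \<forall>y\<in>carrier E.
        Lcls E x = Lcls E y \<longrightarrow> Pcls E (act E g x) = Pcls E (act E g y)"
    and "\<forall>x\<in>carrier E. \<forall>y\<in>orbit G (act E) x. deg E y = deg E x"
    and "\<forall>x\<in>carrier E. \<forall>y\<in>carrier E.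
        Pcls E x = Pcls E y \<longleftrightarrow> Pcls E (nakayama G g E x) = Pcls E (nakayama G g E y)"
    and "\<forall>x\<in>carrier E. \<forall>y\<in>carrier E.
        Lcls E x = Lcls E y \<longleftrightarrow> Lcls E (nakayama G g E x) = Lcls E (nakayama G g E y)"
    and "\<forall>x\<in>carrier E. \<forall>y\<in>carrier E. \<not> strict_sublist (Lseq G g E x) (Lseq G g E y)"
  using fbc unfolding fbc_def by - (elim conjE, assumption)+

text \<open>(f4) and (f5) are reversed so that the Nakayama side stands on the left, as
  \<open>tau_block_nakayama_iff\<close> expects.\<close>

lemmas deg_pos = fbc_conditions(1)[rule_format]
  and f1 = fbc_conditions(2)[rule_format, THEN conjunct1]
  and f1_finite = fbc_conditions(2)[rule_format, THEN conjunct2]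
  and f2 = fbc_conditions(3)[rule_format]
  and f3 = fbc_conditions(4)[rule_format]
  and f4 = fbc_conditions(5)[rule_format, symmetric]
  and f5 = fbc_conditions(6)[rule_format, symmetric]
  and f6 = fbc_conditions(7)[rule_format]

lemma deg_act: "a \<in> carrier G \<Longrightarrow> x \<in> carrier E \<Longrightarrow> deg E (act E a x) = deg E x"
  using f3 by (auto simp: orbit_def)

lemma Lcls_eq_imp_Pcls_eq:
  "x \<in> carrier E \<Longrightarrow> y \<in> carrier E \<Longrightarrow> Lcls E x = Lcls E y \<Longrightarrow> Pcls E x = Pcls E y"
  using f1[of y] Lcls_mem_iff[of y x] Pcls_mem_iff[of y x] by blast

lemma nakayama_closed [simp]: "x \<in> carrier E \<Longrightarrow> nakayama G g E x \<in> carrier E"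
  by (simp add: nakayama_def)

lemma fwd_walk_props:
  assumes "x \<in> carrier E"
  shows "is_walk G g E (fwd_walk g E n x) \<and> terminal (fwd_walk g E n x) = act E (g [^]\<^bsub>G\<^esub> n) x"
proof (induction n)
  case (Suc n)
  have "act E (g [^]\<^bsub>G\<^esub> Suc n) x = act E g (act E (g [^]\<^bsub>G\<^esub> n) x)"
    using assms by (metis act_mult g_closed nat_pow_Suc2 nat_pow_closed)
  then show ?case using Suc assms by auto
qed (use assms in auto)

lemma bwd_walk_props:
  assumes "x \<in> carrier E"
  shows "is_walk G g E (bwd_walk G g E n x) \<and>
         terminal (bwd_walk G g E n x) = act E (inv\<^bsub>G\<^esub> g [^]\<^bsub>G\<^esub> n) x"
proof (induction n)
  case (Suc n)
  have "act E (inv\<^bsub>G\<^esub> g [^]\<^bsub>G\<^esub> Suc n) x = act E (inv\<^bsub>G\<^esub> g) (act E (inv\<^bsub>G\<^esub> g [^]\<^bsub>G\<^esub> n) x)"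
    using assms by (metis act_mult g_closed inv_closed nat_pow_Suc2 nat_pow_closed)
  then show ?case using Suc assms by auto
qed (use assms in auto)

lemma is_walk_power_walk: "x \<in> carrier E \<Longrightarrow> is_walk G g E (power_walk G g E n x)"
  by (simp add: power_walk_def fwd_walk_props bwd_walk_props)

lemma terminal_power_walk:
  assumes "x \<in> carrier E"
  shows "terminal (power_walk G g E n x) = act E (g [^]\<^bsub>G\<^esub> n) x"
proof (cases n rule: int_cases2)
  case (nonneg k)
  then show ?thesis using fwd_walk_props[OF assms] by (simp add: power_walk_def int_pow_int)
next
  case (nonpos k)
  \<comment> \<open>Both cases of \<open>int_cases2\<close> contain 0, and \<open>power_walk\<close>
    sends 0 to its forward branch, so \<open>k = 0\<close> is treated apart.\<close>
  have "terminal (power_walk G g E n x) = act E (inv\<^bsub>G\<^esub> g [^]\<^bsub>G\<^esub> k) x"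
    using bwd_walk_props[OF assms, of k] nonpos by (cases "k = 0") (simp_all add: power_walk_def)
  also have "inv\<^bsub>G\<^esub> g [^]\<^bsub>G\<^esub> k = g [^]\<^bsub>G\<^esub> n"
    unfolding nonpos int_pow_neg_int[OF g_closed] nat_pow_inv[OF g_closed] ..
  finally show ?thesis .
qed

section \<open>Calculus of homotopies\<close>

abbreviation walk :: "'a walk \<Rightarrow> bool" where
  "walk \<equiv> is_walk G g E"

abbreviation htp :: "'a walk \<Rightarrow> 'a walk \<Rightarrow> bool" where
  "htp \<equiv> homotopic G g E"

abbreviation cls :: "'a walk \<Rightarrow> 'a walk set" where
  "cls \<equiv> hclass G g E"

lemma htp_refl: "walk w \<Longrightarrow> htp w w"
  by (rule homotopic.refl)

lemma htp_sym: "htp u v \<Longrightarrow> htp v u"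
  by (rule homotopic.sym)

lemma htp_trans [trans]: "htp u v \<Longrightarrow> htp v w \<Longrightarrow> htp u w"
  by (rule homotopic.trans)

lemma terminal_walk: "walk w \<Longrightarrow> terminal w \<in> carrier E"
  by (rule terminal_in_carrier)

text \<open>A representative of \<open>g\<^sup>n \<cdot> w\<close>, where \<open>w\<close> stands for its class.\<close>

definition pw :: "int \<Rightarrow> 'a walk \<Rightarrow> 'a walk" where
  "pw n w = walk_comp (power_walk G g E n (terminal w)) w"

lemma source_pw [simp]: "source (pw n w) = source w"
  by (simp add: pw_def)

lemma terminal_pw: "walk w \<Longrightarrow> terminal (pw n w) = act E (g [^]\<^bsub>G\<^esub> n) (terminal w)"
  by (simp add: pw_def terminal_walk_comp terminal_power_walk terminal_walk)

lemma walk_pw: "walk w \<Longrightarrow> walk (pw n w)"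
  by (simp add: pw_def is_walk_walk_comp is_walk_power_walk terminal_walk)

lemma pw_0 [simp]: "pw 0 w = w"
  by (simp add: pw_def power_walk_def)

lemma power_walk_1: "power_walk G g E 1 x = Step (act E g x) Fwd (Triv x)"
  by (simp add: power_walk_def)

lemma power_walk_deg: "x \<in> carrier E \<Longrightarrow> terminal (power_walk G g E (int (deg E x)) x) = nakayama G g E x"
  by (simp add: terminal_power_walk nakayama_def int_pow_int)

text \<open>The generating relations preserve endpoints. That both sides are walks rests on (f4) for
  the upper \<open>Tau\<close> step of (h3), and on (f2) and the inclusion of L-classes in P-classes
  for the \<open>Tau\<close> steps of (h4).\<close>

lemma homotopic_props:
  "htp u v \<Longrightarrow> walk u \<and> walk v \<and> source u = source v \<and> terminal u = terminal v"
proof (induction rule: homotopic.induct)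
  case (h3 x y)
  then have "Pcls E (nakayama G g E y) = Pcls E (nakayama G g E x)" using f4 by metis
  with h3 show ?case
    by (auto simp: tau_walk_def terminal_walk_comp is_walk_walk_comp is_walk_power_walk
        power_walk_deg)
next
  case (h4 x y)
  then have "Pcls E (act E g y) = Pcls E (act E g x)" "Pcls E y = Pcls E x"
    using f2 Lcls_eq_imp_Pcls_eq by metis+
  with h4 show ?case by (auto simp: tau_walk_def power_walk_1)
qed (auto simp: tau_walk_def is_walk_walk_comp terminal_walk_comp)

lemmas homotopic_walk = homotopic_props[THEN conjunct1] homotopic_props[THEN conjunct2, THEN conjunct1]
lemmas homotopic_source = homotopic_props[THEN conjunct2, THEN conjunct2, THEN conjunct1]
lemmas homotopic_terminal = homotopic_props[THEN conjunct2, THEN conjunct2, THEN conjunct2]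

lemma homotopic_Step:
  assumes "htp u v" and "y \<in> carrier E" and "valid_step G g E y \<delta> (terminal u)"
  shows "htp (Step y \<delta> u) (Step y \<delta> v)"
  using homotopic.h5_left[OF assms(1), of "Step y \<delta> (Triv (terminal u))"] assms
    homotopic_props[OF assms(1)] terminal_walk by force

lemma homotopic_pw: "htp u v \<Longrightarrow> htp (pw n u) (pw n v)"
  unfolding pw_def
  using homotopic_props[of u v] terminal_walk[of u]
  by (metis homotopic.h5_left is_walk_power_walk source_power_walk)

text \<open>Here and in the next lemmas, (h1) to (h4) are moved to the end of an arbitrary walk by
  right composition, (h5).\<close>

lemma homotopic_bwd_fwd:
  "walk w \<Longrightarrow> htp (Step (terminal w) Bwd (Step (act E g (terminal w)) Fwd w)) w"
  using homotopic.h5_right[OF homotopic.h1_bwd_fwd, of "terminal w" E G g w] terminal_walk[of w]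
  by simp

lemma homotopic_fwd_bwd:
  "walk w \<Longrightarrow> htp (Step (terminal w) Fwd (Step (act E (inv\<^bsub>G\<^esub> g) (terminal w)) Bwd w)) w"
  using homotopic.h5_right[OF homotopic.h1_fwd_bwd, of "terminal w" E G g w] terminal_walk[of w]
  by simp

lemma homotopic_tau_refl: "walk w \<Longrightarrow> htp (Step (terminal w) Tau w) w"
  using homotopic.h5_right[OF homotopic.h1_tau, of "terminal w" E G g w] terminal_walk[of w]
  by (simp add: tau_walk_def)

lemma homotopic_tau_tau:
  assumes "walk w" "y \<in> carrier E" "z \<in> carrier E"
    "Pcls E y = Pcls E (terminal w)" "Pcls E z = Pcls E y"
  shows "htp (Step z Tau (Step y Tau w)) (Step z Tau w)"
  using homotopic.h5_right[OF homotopic.h2, of "terminal w" E y z G g w] terminal_walk[of w] assms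
  by (simp add: tau_walk_def)

lemma homotopic_tau_nakayama:
  assumes "walk w" "y \<in> carrier E" "Pcls E y = Pcls E (terminal w)"
  shows "htp (Step (nakayama G g E y) Tau (pw (int (deg E (terminal w))) w))
             (pw (int (deg E y)) (Step y Tau w))"
  using homotopic.h5_right[OF homotopic.h3, of "terminal w" E y G g w] terminal_walk[of w] assms
  by (simp add: tau_walk_def pw_def walk_comp_assoc)

lemma homotopic_tau_fwd:
  assumes "walk w" "y \<in> carrier E" "Lcls E y = Lcls E (terminal w)"
  shows "htp (Step (act E g y) Tau (pw 1 w)) (pw 1 (Step y Tau w))"
  using homotopic.h5_right[OF homotopic.h4, of "terminal w" E y G g w] terminal_walk[of w] assms
  by (simp add: tau_walk_def pw_def walk_comp_assoc)

text \<open>For \<open>n\<close> at least 0 both sides are the same walk. For negative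
  \<open>n\<close>, \<open>pw n w\<close> is \<open>pw (n + 1) w\<close> followed by a
  \<open>Bwd\<close> step, which the added \<open>Fwd\<close> step cancels by (h1).\<close>

lemma pw_succ:
  assumes "walk w"
  shows "htp (pw (n + 1) w) (Step (act E g (terminal (pw n w))) Fwd (pw n w))"
proof (cases "0 \<le> n")
  case True
  have src: "source (power_walk G g E n (terminal w)) = terminal w" by simp
  have "nat (n + 1) = Suc (nat n)" using True by simp
  then have "pw (n + 1) w = Step (act E g (terminal (pw n w))) Fwd (pw n w)"
    using True terminal_walk_comp[OF src] by (simp add: pw_def power_walk_def)
  then show ?thesis using walk_pw[OF assms, of "n + 1"] htp_refl by metis
next
  case False
  define u where "u = pw (n + 1) w"
  have u: "walk u" using assms walk_pw by (simp add: u_def)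
  have src: "source (bwd_walk G g E (nat (- (n + 1))) (terminal w)) = terminal w" by simp
  have "nat (- n) = Suc (nat (- (n + 1)))" using False by simp
  \<comment> \<open>For \<open>n = -1\<close> the walk \<open>u\<close> comes from the forward
    branch of \<open>power_walk\<close>, hence the case split.\<close>
  then have eq: "pw n w = Step (act E (inv\<^bsub>G\<^esub> g) (terminal u)) Bwd u"
    using False terminal_walk_comp[OF src] by (cases "n = -1") (simp_all add: u_def pw_def power_walk_def)
  show ?thesis
    using htp_sym[OF homotopic_fwd_bwd[OF u]] terminal_walk[OF u] eq
    by (simp add: u_def)
qed

text \<open>Follows from \<open>pw_succ\<close> at \<open>n - 1\<close>: a \<open>Bwd\<close> step
  appended to both sides cancels the last \<open>Fwd\<close>.\<close>

lemma pw_pred: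
  assumes "walk w"
  shows "htp (pw (n - 1) w) (Step (act E (inv\<^bsub>G\<^esub> g) (terminal (pw n w))) Bwd (pw n w))"
proof -
  let ?u = "pw (n - 1) w"
  let ?v = "Step (act E g (terminal ?u)) Fwd ?u"
  have u: "walk ?u" using assms by (rule walk_pw)
  have t: "terminal ?u \<in> carrier E" using terminal_walk[OF u] .
  have nu: "htp (pw n w) ?v" using pw_succ[OF assms, of "n - 1"] by simp
  have tn: "terminal (pw n w) = act E g (terminal ?u)" using homotopic_terminal[OF nu] by simp
  have "htp (Step (terminal ?u) Bwd (pw n w)) (Step (terminal ?u) Bwd ?v)"
    by (rule homotopic_Step[OF nu t]) (simp add: tn t)
  then have "htp (Step (terminal ?u) Bwd (pw n w)) ?u"
    using homotopic_bwd_fwd[OF u] htp_trans by blast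
  then show ?thesis using tn t htp_sym by simp
qed

text \<open>Two-sided induction on \<open>m\<close> from 0, with \<open>pw_succ\<close> and
  \<open>pw_pred\<close> as the recursion. This is the multiplicativity of the action on
  classes.\<close>

lemma pw_add:
  assumes "walk w"
  shows "htp (pw (m + n) w) (pw m (pw n w))"
proof (induction m rule: int_induct[where k = 0])
  case base
  then show ?case using htp_refl walk_pw[OF assms] by simp
next
  case (step1 m)
  have "htp (pw (m + 1 + n) w) (Step (act E g (terminal (pw (m + n) w))) Fwd (pw (m + n) w))"
    using pw_succ[OF assms, of "m + n"] by (simp add: algebra_simps)
  also have "htp \<dots> (Step (act E g (terminal (pw (m + n) w))) Fwd (pw m (pw n w)))"
    by (rule homotopic_Step[OF step1(2)]) (use terminal_walk walk_pw[OF assms] in auto)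
  also have "htp \<dots> (pw (m + 1) (pw n w))"
    using htp_sym[OF pw_succ[OF walk_pw[OF assms], of m n]] homotopic_terminal[OF step1(2)] by simp
  finally show ?case .
next
  case (step2 m)
  have "htp (pw (m - 1 + n) w) (Step (act E (inv\<^bsub>G\<^esub> g) (terminal (pw (m + n) w))) Bwd (pw (m + n) w))"
    using pw_pred[OF assms, of "m + n"] by (simp add: algebra_simps)
  also have "htp \<dots> (Step (act E (inv\<^bsub>G\<^esub> g) (terminal (pw (m + n) w))) Bwd (pw m (pw n w)))"
    by (rule homotopic_Step[OF step2(2)]) (use terminal_walk walk_pw[OF assms] in auto)
  also have "htp \<dots> (pw (m - 1) (pw n w))"
    using htp_sym[OF pw_pred[OF walk_pw[OF assms], of m n]] homotopic_terminal[OF step2(2)] by simp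
  finally show ?case .
qed

text \<open>Applying the power \<open>- n\<close> undoes the power \<open>n\<close>. This supplies
  the directions of (f4) and (f5) upstairs that strip off powers of \<open>g\<close>.\<close>

lemma pw_cancel:
  assumes "htp (pw n u) (pw n v)" and "walk u" and "walk v"
  shows "htp u v"
proof -
  have "htp (pw (- n + n) w) (pw (- n) (pw n w))" if "walk w" for w
    using pw_add[OF that] .
  then show ?thesis
    using homotopic_pw[OF assms(1), of "- n"] assms(2,3)
    by (metis add.left_inverse htp_sym htp_trans pw_0)
qed

section \<open>The universal cover is a fractional Brauer configuration\<close>

lemma cls_eq_iff: "walk u \<Longrightarrow> cls u = cls v \<longleftrightarrow> htp u v"
  unfolding hclass_def
  by (metis (mono_tags, lifting) Collect_cong htp_refl htp_sym htp_trans mem_Collect_eq)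

lemma rep_cls: "walk w \<Longrightarrow> htp w (rep (cls w))"
  unfolding rep_def hclass_def by (metis htp_refl mem_Collect_eq someI_ex)

lemma terminal_rep [simp]: "walk w \<Longrightarrow> terminal (rep (cls w)) = terminal w"
  using homotopic_terminal[OF rep_cls] by simp

lemma cls_in_uc_carrier: "walk w \<Longrightarrow> cls w \<in> uc_carrier G g E (source w)"
  by (auto simp: uc_carrier_def)

lemma uc_carrierE:
  assumes "W \<in> uc_carrier G g E e"
  obtains w where "walk w" "source w = e" "W = cls w"
  using assms by (auto simp: uc_carrier_def)

text \<open>Independence of the representative: \<open>rep (cls w)\<close> is homotopic to
  \<open>w\<close>, and powers respect homotopy.\<close>

lemma uc_act_cls:
  assumes "walk w" "source w = e"
  shows "uc_act G g E e (g [^]\<^bsub>G\<^esub> (n::int)) (cls w) = cls (pw n w)"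
proof -
  have "cls w \<in> uc_carrier G g E e" using assms cls_in_uc_carrier by blast
  then have "uc_act G g E e (g [^]\<^bsub>G\<^esub> n) (cls w) = cls (pw n (rep (cls w)))"
    by (simp add: uc_act_def pw_def)
  also have "\<dots> = cls (pw n w)"
    using homotopic_pw[OF rep_cls[OF assms(1)], of n] cls_eq_iff walk_pw[OF assms(1)] by metis
  finally show ?thesis .
qed

lemma uc_group_action: "group_action G (uc_carrier G g E e) (uc_act G g E e)"
proof (rule group_actionI)
  show "group G" by (rule is_group)
  show "uc_act G g E e a \<in> extensional (uc_carrier G g E e)" for a
    by (simp add: uc_act_def)
  show "uc_act G g E e a W \<in> uc_carrier G g E e"
    if "a \<in> carrier G" "W \<in> uc_carrier G g E e" for a W
    using carrier_power[OF that(1)] that(2)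
    by (metis cls_in_uc_carrier source_pw uc_act_cls uc_carrierE walk_pw)
  show "uc_act G g E e \<one>\<^bsub>G\<^esub> W = W" if "W \<in> uc_carrier G g E e" for W
    using that uc_act_cls[of _ e 0] by (elim uc_carrierE) (simp add: int_pow_0)
  show "uc_act G g E e (a \<otimes>\<^bsub>G\<^esub> b) W = uc_act G g E e a (uc_act G g E e b W)"
    if ab: "a \<in> carrier G" "b \<in> carrier G" and W: "W \<in> uc_carrier G g E e" for a b W
  proof -
    obtain m n :: int where a: "a = g [^]\<^bsub>G\<^esub> m" and b: "b = g [^]\<^bsub>G\<^esub> n"
      using carrier_power[OF ab(1)] carrier_power[OF ab(2)] by blast
    obtain w where w: "walk w" "source w = e" "W = cls w" using W by (rule uc_carrierE)
    have "uc_act G g E e (a \<otimes>\<^bsub>G\<^esub> b) W = cls (pw (m + n) w)"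
      using uc_act_cls[OF w(1,2), of "m + n"] by (simp add: a b w(3) int_pow_mult)
    also have "\<dots> = cls (pw m (pw n w))"
      using pw_add[OF w(1)] cls_eq_iff walk_pw[OF w(1)] by blast
    also have "\<dots> = uc_act G g E e a (uc_act G g E e b W)"
      using w by (simp add: a b uc_act_cls walk_pw)
    finally show ?thesis .
  qed
qed

text \<open>The blocks of both partitions of the universal cover, treated uniformly in \<open>K\<close>, which is
  \<open>Pcls E\<close> or \<open>Lcls E\<close>.\<close>

definition tau_block :: "('a \<Rightarrow> 'a set) \<Rightarrow> 'a walk set \<Rightarrow> 'a walk set set" where
  "tau_block K W = {cls (walk_comp (tau_walk h (terminal (rep W))) (rep W)) | h. h \<in> K (terminal (rep W))}"

text \<open>What the block arguments need of \<open>K\<close>: it gives the classes of a partition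
  finer than \<open>Ppart E\<close>, so that a \<open>Tau\<close> step inside a class of
  \<open>K\<close> is legal.\<close>

definition refines_P :: "('a \<Rightarrow> 'a set) \<Rightarrow> bool" where
  "refines_P K \<longleftrightarrow> (\<forall>x\<in>carrier E. K x \<subseteq> Pcls E x \<and>
     (\<forall>y. y \<in> K x \<longleftrightarrow> y \<in> carrier E \<and> K y = K x))"

lemma refines_Pcls: "refines_P (Pcls E)" and refines_Lcls: "refines_P (Lcls E)"
  unfolding refines_P_def using f1 Pcls_mem_iff Lcls_mem_iff by simp_all

lemma uc_Pcls_eq: "uc_Pcls G g E W = tau_block (Pcls E) W"
  and uc_Lcls_eq: "uc_Lcls G g E W = tau_block (Lcls E) W"
  by (simp_all add: uc_Pcls_def uc_Lcls_def tau_block_def)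

lemma refines_P_mem:
  assumes "refines_P K" "x \<in> carrier E"
  shows "y \<in> K x \<longleftrightarrow> y \<in> carrier E \<and> K y = K x"
  using assms unfolding refines_P_def by blast

lemma refines_P_Pcls:
  assumes "refines_P K" "x \<in> carrier E" "y \<in> K x"
  shows "Pcls E y = Pcls E x"
proof -
  have "y \<in> Pcls E x" using assms unfolding refines_P_def by blast
  then show ?thesis using Pcls_mem_iff[OF assms(2)] by blast
qed

lemma tau_block_cls:
  assumes "refines_P K" "walk w"
  shows "tau_block K (cls w) = {cls (Step h Tau w) | h. h \<in> K (terminal w)}"
proof -
  have t: "terminal w \<in> carrier E" using assms(2) by (rule terminal_walk)
  have "cls (Step h Tau (rep (cls w))) = cls (Step h Tau w)" if h: "h \<in> K (terminal w)" for h
  proof -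
    have "h \<in> carrier E" using refines_P_mem[OF assms(1) t] h by simp
    then have "htp (Step h Tau w) (Step h Tau (rep (cls w)))"
      using refines_P_Pcls[OF assms(1) t h] by (intro homotopic_Step rep_cls assms) auto
    then show ?thesis using cls_eq_iff homotopic_walk by metis
  qed
  then show ?thesis
    using assms(2) by (auto simp: tau_block_def tau_walk_def)
qed

lemma walk_Step_tau:
  assumes "refines_P K" "walk w" "h \<in> K (terminal w)"
  shows "walk (Step h Tau w)"
proof -
  have t: "terminal w \<in> carrier E" using assms(2) by (rule terminal_walk)
  show ?thesis
    using refines_P_mem[OF assms(1) t] refines_P_Pcls[OF assms(1) t assms(3)] assms by simp
qed

text \<open>Homotopic walks end at the same point, so the \<open>h\<close> that witnesses membership
  must be \<open>terminal v\<close>.\<close>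

lemma cls_mem_tau_block_iff:
  assumes "refines_P K" "walk w" "walk v"
  shows "cls v \<in> tau_block K (cls w) \<longleftrightarrow>
    K (terminal v) = K (terminal w) \<and> htp (Step (terminal v) Tau w) v"
proof -
  have t: "terminal w \<in> carrier E" and tv: "terminal v \<in> carrier E"
    using assms(2,3) terminal_walk by blast+
  have "cls v \<in> tau_block K (cls w) \<longleftrightarrow> (\<exists>h. h \<in> K (terminal w) \<and> htp (Step h Tau w) v)"
    unfolding tau_block_cls[OF assms(1,2)]
    using cls_eq_iff walk_Step_tau[OF assms(1,2)] by blast
  also have "\<dots> \<longleftrightarrow> terminal v \<in> K (terminal w) \<and> htp (Step (terminal v) Tau w) v"
    using homotopic_terminal by fastforce
  finally show ?thesis using refines_P_mem[OF assms(1) t] tv by simp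
qed

lemma cls_mem_tau_block_self: "refines_P K \<Longrightarrow> walk w \<Longrightarrow> cls w \<in> tau_block K (cls w)"
  by (simp add: cls_mem_tau_block_iff homotopic_tau_refl)

lemma tau_block_subset:
  assumes "refines_P K" "W \<in> uc_carrier G g E e"
  shows "tau_block K W \<subseteq> uc_carrier G g E e"
  using assms(2)
proof (rule uc_carrierE)
  fix w assume w: "walk w" "source w = e" "W = cls w"
  have "cls (Step h Tau w) \<in> uc_carrier G g E e" if "h \<in> K (terminal w)" for h
    using cls_in_uc_carrier[OF walk_Step_tau[OF assms(1) w(1) that]] w(2) by simp
  then show ?thesis unfolding w(3) tau_block_cls[OF assms(1) w(1)] by blast
qed

text \<open>By (h2), two successive \<open>Tau\<close> steps merge into one.\<close>

lemma tau_block_Step_subset: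
  assumes "refines_P K" "walk w" "h \<in> K (terminal w)"
  shows "tau_block K (cls (Step h Tau w)) \<subseteq> tau_block K (cls w)"
proof
  fix X assume X: "X \<in> tau_block K (cls (Step h Tau w))"
  have t: "terminal w \<in> carrier E" using assms(2) by (rule terminal_walk)
  have h: "h \<in> carrier E" "K h = K (terminal w)" using refines_P_mem[OF assms(1) t] assms(3) by auto
  obtain k where k: "X = cls (Step k Tau (Step h Tau w))" "k \<in> K h"
    using X unfolding tau_block_cls[OF assms(1) walk_Step_tau[OF assms]] by auto
  have kc: "k \<in> carrier E" using refines_P_mem[OF assms(1) h(1)] k(2) by simp
  have "htp (Step k Tau (Step h Tau w)) (Step k Tau w)"
    by (rule homotopic_tau_tau)
      (use assms(2) h kc refines_P_Pcls[OF assms(1) t assms(3)] refines_P_Pcls[OF assms(1) h(1) k(2)] in auto)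
  then have "X = cls (Step k Tau w)" using k(1) cls_eq_iff homotopic_walk by metis
  then show "X \<in> tau_block K (cls w)"
    unfolding tau_block_cls[OF assms(1,2)] using h(2) k(2) by auto
qed

text \<open>The inclusion \<open>tau_block_Step_subset\<close> is used twice: for the
  \<open>Tau\<close> step to \<open>h\<close>, and for the step back to \<open>terminal w\<close>,
  which returns to the class of \<open>w\<close> by (h2) and (h1).\<close>

lemma tau_block_mem_eq:
  assumes "refines_P K" "W \<in> uc_carrier G g E e" "V \<in> tau_block K W"
  shows "tau_block K V = tau_block K W"
  using assms(2)
proof (rule uc_carrierE)
  fix w assume w: "walk w" "source w = e" "W = cls w"
  have t: "terminal w \<in> carrier E" using w(1) by (rule terminal_walk)
  obtain h where h: "V = cls (Step h Tau w)" "h \<in> K (terminal w)"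
    using assms(3) unfolding w(3) tau_block_cls[OF assms(1) w(1)] by auto
  let ?u = "Step h Tau w"
  have u: "walk ?u" using walk_Step_tau[OF assms(1) w(1) h(2)] .
  have hc: "h \<in> carrier E" "K h = K (terminal w)" using refines_P_mem[OF assms(1) t] h by auto
  have tu: "terminal w \<in> K (terminal ?u)" using refines_P_mem[OF assms(1) hc(1)] t hc(2) by simp
  have "htp (Step (terminal w) Tau ?u) (Step (terminal w) Tau w)"
    by (rule homotopic_tau_tau)
      (use w(1) hc(1) t refines_P_Pcls[OF assms(1) t h(2)] in auto)
  then have "htp (Step (terminal w) Tau ?u) w"
    using homotopic_tau_refl[OF w(1)] htp_trans by blast
  then have "cls (Step (terminal w) Tau ?u) = cls w"
    using cls_eq_iff homotopic_walk by metis
  then show ?thesis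
    using tau_block_Step_subset[OF assms(1) w(1) h(2)] tau_block_Step_subset[OF assms(1) u tu]
    unfolding h(1) w(3) by auto
qed

lemma tau_block_eq_iff:
  assumes "refines_P K" "walk w" "walk v" "source v = source w"
  shows "tau_block K (cls v) = tau_block K (cls w) \<longleftrightarrow>
    K (terminal v) = K (terminal w) \<and> htp (Step (terminal v) Tau w) v"
  using tau_block_mem_eq[OF assms(1) cls_in_uc_carrier[OF assms(2)]]
    cls_mem_tau_block_self[OF assms(1,3)] cls_mem_tau_block_iff[OF assms(1-3)] by blast

text \<open>This yields (f4) and (f5) upstairs. Equality of blocks splits into a condition on
  terminals, settled by \<open>KN\<close>, and a homotopy, settled by (h3) and cancellation of
  powers.\<close>

lemma tau_block_nakayama_iff:
  assumes K: "refines_P K" and w: "walk w" and v: "walk v" and src: "source v = source w"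
    and KN: "\<And>x y. x \<in> carrier E \<Longrightarrow> y \<in> carrier E \<Longrightarrow>
        K (nakayama G g E x) = K (nakayama G g E y) \<longleftrightarrow> K x = K y"
  shows "tau_block K (cls (pw (int (deg E (terminal v))) v)) =
           tau_block K (cls (pw (int (deg E (terminal w))) w)) \<longleftrightarrow>
         tau_block K (cls v) = tau_block K (cls w)"
proof -
  let ?v = "terminal v" and ?w = "terminal w"
  let ?V = "pw (int (deg E ?v)) v" and ?W = "pw (int (deg E ?w)) w"
  have t: "?v \<in> carrier E" "?w \<in> carrier E" using v w terminal_walk by blast+
  have tN: "terminal ?V = nakayama G g E ?v" "terminal ?W = nakayama G g E ?w"
    using v w by (simp_all add: terminal_pw nakayama_def int_pow_int)
  have "tau_block K (cls ?V) = tau_block K (cls ?W) \<longleftrightarrow>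
      K ?v = K ?w \<and> htp (Step (nakayama G g E ?v) Tau ?W) ?V"
    using tau_block_eq_iff[OF K walk_pw[OF w] walk_pw[OF v]] src KN[OF t] by (simp add: tN)
  also have "\<dots> \<longleftrightarrow> K ?v = K ?w \<and> htp (Step ?v Tau w) v"
  proof (intro conj_cong HOL.refl)
    assume "K ?v = K ?w"
    then have "?v \<in> K ?w" using refines_P_mem[OF K t(2)] t(1) by simp
    note P = refines_P_Pcls[OF K t(2) this] and step = walk_Step_tau[OF K w this]
    \<comment> \<open>(h3) trades the exponent \<open>deg E ?w\<close> for \<open>deg E ?v\<close>,
      so both walks to be compared become the same power.\<close>
    have N: "htp (Step (nakayama G g E ?v) Tau ?W) (pw (int (deg E ?v)) (Step ?v Tau w))"
      by (rule homotopic_tau_nakayama[OF w t(1) P])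
    show "htp (Step (nakayama G g E ?v) Tau ?W) ?V \<longleftrightarrow> htp (Step ?v Tau w) v"
    proof
      assume "htp (Step (nakayama G g E ?v) Tau ?W) ?V"
      then have "htp (pw (int (deg E ?v)) (Step ?v Tau w)) ?V"
        using N htp_sym htp_trans by blast
      then show "htp (Step ?v Tau w) v" using pw_cancel step v by blast
    next
      assume "htp (Step ?v Tau w) v"
      then show "htp (Step (nakayama G g E ?v) Tau ?W) ?V"
        using N homotopic_pw htp_trans by blast
    qed
  qed
  also have "\<dots> \<longleftrightarrow> tau_block K (cls v) = tau_block K (cls w)"
    using tau_block_eq_iff[OF K w v src] by simp
  finally show ?thesis .
qed

text \<open>The inverse appends to \<open>w\<close> the \<open>Tau\<close> step to \<open>h\<close>.
  The bijection serves finiteness in (f1), the comparison of sequences in (f6), and bijectivity of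
  maps out of the universal cover.\<close>

lemma bij_betw_tau_block:
  assumes "refines_P K" "walk w"
  shows "bij_betw (\<lambda>W. terminal (rep W)) (tau_block K (cls w)) (K (terminal w))"
proof (rule bij_betw_byWitness[where f' = "\<lambda>h. cls (Step h Tau w)"])
  have rep: "terminal (rep (cls (Step h Tau w))) = h" if "h \<in> K (terminal w)" for h
    using terminal_rep[OF walk_Step_tau[OF assms that]] by simp
  show "\<forall>W\<in>tau_block K (cls w). cls (Step (terminal (rep W)) Tau w) = W"
    using rep unfolding tau_block_cls[OF assms] by auto
  show "\<forall>h\<in>K (terminal w). terminal (rep (cls (Step h Tau w))) = h" using rep by blast
  show "(\<lambda>W. terminal (rep W)) ` tau_block K (cls w) \<subseteq> K (terminal w)"
    using rep unfolding tau_block_cls[OF assms] by auto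
  show "(\<lambda>h. cls (Step h Tau w)) ` K (terminal w) \<subseteq> tau_block K (cls w)"
    unfolding tau_block_cls[OF assms] by auto
qed

lemma partition_tau_block:
  assumes "refines_P K"
  shows "partition_on (uc_carrier G g E e) (tau_block K ` uc_carrier G g E e)"
proof (rule partition_on_image)
  show "W \<in> tau_block K W" if "W \<in> uc_carrier G g E e" for W
    using that by (rule uc_carrierE) (simp add: cls_mem_tau_block_self assms)
qed (use tau_block_subset tau_block_mem_eq assms in blast)+

section \<open>Verification of the axioms for the universal cover\<close>

abbreviation ucov :: "'a \<Rightarrow> ('g, 'a walk set) fbc_data" where
  "ucov e \<equiv> univ_cover G g E e"

lemma carrier_ucov [simp]: "carrier (ucov e) = uc_carrier G g E e"
  and act_ucov [simp]: "act (ucov e) = uc_act G g E e"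
  and deg_ucov: "deg (ucov e) W = deg E (terminal (rep W))"
  and Ppart_ucov: "Ppart (ucov e) = tau_block (Pcls E) ` uc_carrier G g E e"
  and Lpart_ucov: "Lpart (ucov e) = tau_block (Lcls E) ` uc_carrier G g E e"
  by (simp_all add: univ_cover_def uc_Pcls_eq uc_Lcls_eq)

lemma Pcls_ucov: "W \<in> uc_carrier G g E e \<Longrightarrow> Pcls (ucov e) W = tau_block (Pcls E) W"
  unfolding Pcls_def[of "ucov e"] Ppart_ucov
  by (rule partition_on_THE_eq[OF partition_tau_block[OF refines_Pcls]])
    (auto elim!: uc_carrierE simp: cls_mem_tau_block_self refines_Pcls)

lemma Lcls_ucov: "W \<in> uc_carrier G g E e \<Longrightarrow> Lcls (ucov e) W = tau_block (Lcls E) W"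
  unfolding Lcls_def[of "ucov e"] Lpart_ucov
  by (rule partition_on_THE_eq[OF partition_tau_block[OF refines_Lcls]])
    (auto elim!: uc_carrierE simp: cls_mem_tau_block_self refines_Lcls)

lemma nakayama_ucov:
  assumes "walk w" "source w = e"
  shows "nakayama G g (ucov e) (cls w) = cls (pw (int (deg E (terminal w))) w)"
  using uc_act_cls[OF assms, of "int (deg E (terminal w))"] assms
  by (simp add: nakayama_def deg_ucov int_pow_int)

text \<open>The projection maps each L-class onto the L-class below. A proper block upstairs would
  therefore give one in \<open>E\<close>, against (f6).\<close>

lemma Lseq_ucov:
  assumes "walk w" "source w = e"
  shows "map ((`) (\<lambda>W. terminal (rep W))) (Lseq G g (ucov e) (cls w)) = Lseq G g E (terminal w)"
proof -
  have "(\<lambda>W. terminal (rep W)) ` Lcls (ucov e) (act (ucov e) (g [^]\<^bsub>G\<^esub> i) (cls w)) =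
      Lcls E (act E (g [^]\<^bsub>G\<^esub> i) (terminal w))" for i :: nat
  proof -
    let ?u = "pw (int i) w"
    have "act (ucov e) (g [^]\<^bsub>G\<^esub> i) (cls w) = cls ?u"
      using uc_act_cls[OF assms, of "int i"] by (simp add: int_pow_int)
    moreover have "cls ?u \<in> uc_carrier G g E e"
      using cls_in_uc_carrier[OF walk_pw[OF assms(1)]] assms(2) by simp
    moreover have "terminal ?u = act E (g [^]\<^bsub>G\<^esub> i) (terminal w)"
      using assms(1) by (simp add: terminal_pw int_pow_int)
    ultimately show ?thesis
      using bij_betw_tau_block[OF refines_Lcls walk_pw[OF assms(1), of "int i"]]
      by (simp add: Lcls_ucov bij_betw_def)
  qed
  then show ?thesis using assms by (simp add: Lseq_def deg_ucov)
qed

lemma fbc_ucov: "fbc G g (ucov e)"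
  unfolding fbc_def
proof (intro conjI ballI impI)
  show "group_action G (carrier (ucov e)) (act (ucov e))" by (simp add: uc_group_action)
  show "partition_on (carrier (ucov e)) (Ppart (ucov e))"
    by (simp add: Ppart_ucov partition_tau_block refines_Pcls)
  show "partition_on (carrier (ucov e)) (Lpart (ucov e))"
    by (simp add: Lpart_ucov partition_tau_block refines_Lcls)
next
  fix X assume "X \<in> carrier (ucov e)"
  then have X: "X \<in> uc_carrier G g E e" by simp
  then obtain w where w: "walk w" "source w = e" "X = cls w" by (rule uc_carrierE)
  have t: "terminal w \<in> carrier E" using w(1) by (rule terminal_walk)
  show "0 < deg (ucov e) X" using w t by (simp add: deg_ucov deg_pos)
  show "Lcls (ucov e) X \<subseteq> Pcls (ucov e) X"
    using f1[OF t] unfolding w(3) Lcls_ucov[OF X, unfolded w(3)] Pcls_ucov[OF X, unfolded w(3)]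
      tau_block_cls[OF refines_Lcls w(1)] tau_block_cls[OF refines_Pcls w(1)] by auto
  show "finite (Pcls (ucov e) X)"
    using bij_betw_finite[OF bij_betw_tau_block[OF refines_Pcls w(1)]] f1_finite[OF t]
    unfolding w(3) Pcls_ucov[OF X, unfolded w(3)] by simp
  show "deg (ucov e) Y = deg (ucov e) X" if Y: "Y \<in> orbit G (act (ucov e)) X" for Y
  proof -
    obtain a where a: "a \<in> carrier G" "Y = uc_act G g E e a X"
      using Y by (auto simp: orbit_def)
    obtain n :: int where "a = g [^]\<^bsub>G\<^esub> n" using carrier_power[OF a(1)] by blast
    then have "Y = cls (pw n w)" using a(2) uc_act_cls[OF w(1,2)] w(3) by simp
    then show ?thesis using w t by (simp add: deg_ucov walk_pw terminal_pw deg_act)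
  qed
next
  fix X Y assume "X \<in> carrier (ucov e)" "Y \<in> carrier (ucov e)"
  then have XY: "X \<in> uc_carrier G g E e" "Y \<in> uc_carrier G g E e" by simp_all
  obtain v where v: "walk v" "source v = e" "X = cls v" using XY(1) by (rule uc_carrierE)
  obtain w where w: "walk w" "source w = e" "Y = cls w" using XY(2) by (rule uc_carrierE)
  have t: "terminal v \<in> carrier E" "terminal w \<in> carrier E" using v(1) w(1) terminal_walk by blast+
  have src: "source v = source w" using v(2) w(2) by simp
  have pw_in: "cls (pw n v) \<in> uc_carrier G g E e" "cls (pw n w) \<in> uc_carrier G g E e" for n
    using cls_in_uc_carrier[OF walk_pw[OF v(1)]] cls_in_uc_carrier[OF walk_pw[OF w(1)]] v(2) w(2)
    by simp_all
  have pw1: "terminal (pw 1 v) = act E g (terminal v)" "terminal (pw 1 w) = act E g (terminal w)"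
    using v(1) w(1) by (simp_all add: terminal_pw int_pow_1)
  show "Pcls (ucov e) (act (ucov e) g X) = Pcls (ucov e) (act (ucov e) g Y)"
    if "Lcls (ucov e) X = Lcls (ucov e) Y"
  proof -
    have "tau_block (Lcls E) (cls v) = tau_block (Lcls E) (cls w)"
      using that XY v w by (simp add: Lcls_ucov)
    then have L: "Lcls E (terminal v) = Lcls E (terminal w)" and h: "htp (Step (terminal v) Tau w) v"
      using tau_block_eq_iff[OF refines_Lcls w(1) v(1) src] by auto
    \<comment> \<open>(h4) moves the \<open>Tau\<close> step past \<open>g\<close>; applying
      \<open>g\<close> to \<open>h\<close> turns the result into \<open>pw 1 v\<close>. Together
      with (f2) in \<open>E\<close> this is the criterion for equal P-blocks.\<close>
    have "htp (Step (act E g (terminal v)) Tau (pw 1 w)) (pw 1 v)"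
      using homotopic_tau_fwd[OF w(1) t(1) L] homotopic_pw[OF h] htp_trans by blast
    then have "tau_block (Pcls E) (cls (pw 1 v)) = tau_block (Pcls E) (cls (pw 1 w))"
      using tau_block_eq_iff[OF refines_Pcls walk_pw[OF w(1)] walk_pw[OF v(1)], of 1 1] src f2[OF t L]
      by (simp add: pw1)
    moreover have "act (ucov e) g X = cls (pw 1 v)" "act (ucov e) g Y = cls (pw 1 w)"
      using uc_act_cls[OF v(1,2), of 1] uc_act_cls[OF w(1,2), of 1] v(3) w(3) by (simp_all add: int_pow_1)
    ultimately show ?thesis by (simp add: Pcls_ucov pw_in)
  qed
  show "Pcls (ucov e) X = Pcls (ucov e) Y \<longleftrightarrow>
      Pcls (ucov e) (nakayama G g (ucov e) X) = Pcls (ucov e) (nakayama G g (ucov e) Y)"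
    using tau_block_nakayama_iff[OF refines_Pcls w(1) v(1) src f4] XY v w
    by (simp add: nakayama_ucov Pcls_ucov pw_in)
  show "Lcls (ucov e) X = Lcls (ucov e) Y \<longleftrightarrow>
      Lcls (ucov e) (nakayama G g (ucov e) X) = Lcls (ucov e) (nakayama G g (ucov e) Y)"
    using tau_block_nakayama_iff[OF refines_Lcls w(1) v(1) src f5] XY v w
    by (simp add: nakayama_ucov Lcls_ucov pw_in)
  show "\<not> strict_sublist (Lseq G g (ucov e) X) (Lseq G g (ucov e) Y)"
    using map_mono_strict_sublist[of "Lseq G g (ucov e) X" "Lseq G g (ucov e) Y" "(`) (\<lambda>W. terminal (rep W))"]
      Lseq_ucov[OF v(1,2)] Lseq_ucov[OF w(1,2)] f6[OF t] v(3) w(3) by auto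
qed

end

section \<open>Lifting walks along a covering\<close>

locale frac_brauer_covering =
  base: frac_brauer G g E + total: frac_brauer G g E'
  for G :: "('g, 'm) monoid_scheme" and g :: 'g
    and E :: "('g, 'a) fbc_data" and E' :: "('g, 'b) fbc_data" +
  fixes f :: "'b \<Rightarrow> 'a"
  assumes covering: "fbc_covering G g E' E f"
begin

lemma f_closed [simp]: "x \<in> carrier E' \<Longrightarrow> f x \<in> carrier E"
  and f_act: "a \<in> carrier G \<Longrightarrow> x \<in> carrier E' \<Longrightarrow> f (act E' a x) = act E a (f x)"
  and f_deg: "x \<in> carrier E' \<Longrightarrow> deg E (f x) = deg E' x"
  and bij_Pcls: "x \<in> carrier E' \<Longrightarrow> bij_betw f (Pcls E' x) (Pcls E (f x))"
  and bij_Lcls: "x \<in> carrier E' \<Longrightarrow> bij_betw f (Lcls E' x) (Lcls E (f x))"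
  using covering by (auto simp: fbc_covering_def fbc_morphism_def)

text \<open>As \<open>f\<close> maps the P-class of \<open>x\<close> bijectively onto that of
  \<open>f x\<close>, this is the only point over \<open>y\<close> in the class of \<open>x\<close>,
  provided that \<open>y\<close> lies in the class of \<open>f x\<close>.\<close>

definition tau_lift :: "'a \<Rightarrow> 'b \<Rightarrow> 'b" where
  "tau_lift y x = inv_into (Pcls E' x) f y"

lemma tau_lift_props:
  assumes "x \<in> carrier E'" "y \<in> carrier E" "Pcls E y = Pcls E (f x)"
  shows "tau_lift y x \<in> Pcls E' x" and "f (tau_lift y x) = y"
    and "tau_lift y x \<in> carrier E'" and "Pcls E' (tau_lift y x) = Pcls E' x"
proof -
  have "y \<in> f ` Pcls E' x"
    using bij_Pcls[OF assms(1)] base.Pcls_mem_iff[of "f x" y] assms by (simp add: bij_betw_def)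
  then show "tau_lift y x \<in> Pcls E' x" "f (tau_lift y x) = y"
    by (simp_all add: tau_lift_def inv_into_into f_inv_into_f)
  then show "tau_lift y x \<in> carrier E'" "Pcls E' (tau_lift y x) = Pcls E' x"
    using total.Pcls_mem_iff[OF assms(1)] by simp_all
qed

text \<open>Injectivity of \<open>f\<close> on the P-class of \<open>x\<close>. Later identities
  between lifted points are reduced to this uniqueness.\<close>

lemma tau_lift_eqI:
  assumes "x \<in> carrier E'" "z \<in> carrier E'" "Pcls E' z = Pcls E' x" "f z = y"
  shows "tau_lift y x = z"
  using inv_into_f_f[of f "Pcls E' x" z] bij_Pcls[OF assms(1)] total.Pcls_mem_iff[OF assms(1)] assms
  by (auto simp: tau_lift_def bij_betw_def)

text \<open>\<open>lift x w\<close> is the terminal of the lift of the walk \<open>w\<close> that starts at \<open>x\<close>.\<close>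

primrec lift :: "'b \<Rightarrow> 'a walk \<Rightarrow> 'b" where
  "lift x (Triv y) = x"
| "lift x (Step y \<delta> w) =
     (case \<delta> of Fwd \<Rightarrow> act E' g (lift x w)
      | Bwd \<Rightarrow> act E' (inv\<^bsub>G\<^esub> g) (lift x w)
      | Tau \<Rightarrow> tau_lift y (lift x w))"

lemma lift_props:
  assumes "base.walk w" "x \<in> carrier E'" "f x = source w"
  shows "lift x w \<in> carrier E' \<and> f (lift x w) = terminal w"
  using assms
proof (induction w)
  case (Step y \<delta> w)
  then have IH: "lift x w \<in> carrier E'" "f (lift x w) = terminal w" by simp_all
  show ?case
  proof (cases \<delta>)
    case Tau
    then have "Pcls E y = Pcls E (f (lift x w))" "y \<in> carrier E" using Step.prems IH by simp_all
    then show ?thesis using Tau tau_lift_props[OF IH(1), of y] by simp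
  qed (use Step.prems IH in \<open>auto simp: f_act\<close>)
qed simp

lemma lift_walk_comp: "lift x (walk_comp u v) = lift (lift x v) u"
  by (induction u) (auto split: letter.split)

text \<open>\<open>lift\<close> consults the vertices of a walk only at \<open>Tau\<close> letters,
  so the formula holds for every \<open>y\<close> at once.\<close>

lemma lift_power_walk:
  assumes "x \<in> carrier E'"
  shows "lift x (power_walk G g E n y) = act E' (g [^]\<^bsub>G\<^esub> n) x"
proof -
  have fwd: "lift x (fwd_walk g E k y) = act E' (g [^]\<^bsub>G\<^esub> k) x" for k
  proof (induction k)
    case (Suc k)
    have "g [^]\<^bsub>G\<^esub> Suc k = g \<otimes>\<^bsub>G\<^esub> g [^]\<^bsub>G\<^esub> k" by (simp only: base.nat_pow_Suc2[OF base.g_closed])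
    then show ?case using Suc assms by (simp add: total.act_mult del: base.nat_pow_Suc)
  qed (use assms in simp)
  have bwd: "lift x (bwd_walk G g E k y) = act E' (inv\<^bsub>G\<^esub> g [^]\<^bsub>G\<^esub> k) x" for k
  proof (induction k)
    case (Suc k)
    have "inv\<^bsub>G\<^esub> g [^]\<^bsub>G\<^esub> Suc k = inv\<^bsub>G\<^esub> g \<otimes>\<^bsub>G\<^esub> inv\<^bsub>G\<^esub> g [^]\<^bsub>G\<^esub> k"
      by (simp only: base.nat_pow_Suc2[OF base.inv_closed[OF base.g_closed]])
    then show ?case using Suc assms by (simp add: total.act_mult del: base.nat_pow_Suc)
  qed (use assms in simp)
  show ?thesis
  proof (cases n rule: int_cases2)
    case (nonneg k)
    then show ?thesis using fwd by (simp add: power_walk_def int_pow_int)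
  next
    case (nonpos k)
    have "lift x (power_walk G g E n y) = act E' (inv\<^bsub>G\<^esub> g [^]\<^bsub>G\<^esub> k) x"
      using bwd[of k] nonpos by (cases "k = 0") (simp_all add: power_walk_def)
    also have "inv\<^bsub>G\<^esub> g [^]\<^bsub>G\<^esub> k = g [^]\<^bsub>G\<^esub> n"
      unfolding nonpos base.int_pow_neg_int[OF base.g_closed] base.nat_pow_inv[OF base.g_closed] ..
    finally show ?thesis .
  qed
qed

lemma lift_power_walk_deg:
  assumes "x \<in> carrier E'" "f x = y"
  shows "lift x (power_walk G g E (int (deg E y)) y) = nakayama G g E' x"
  using lift_power_walk[OF assms(1)] f_deg[OF assms(1)] assms(2)
  by (simp add: nakayama_def int_pow_int)

lemma f_nakayama: "x \<in> carrier E' \<Longrightarrow> f (nakayama G g E' x) = nakayama G g E (f x)"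
  by (simp add: nakayama_def f_act f_deg)

lemma lift_homotopic:
  assumes "base.htp u v" "x \<in> carrier E'" "f x = source u"
  shows "lift x u = lift x v"
  using assms
\<comment> \<open>The starting point is generalised because the case \<open>h5_right\<close> uses
  the induction hypothesis at \<open>lift x v\<close>.\<close>
proof (induction arbitrary: x rule: homotopic.induct)
  case (sym u v)
  then show ?case using base.homotopic_source by metis
next
  case (trans u v w)
  then show ?case using base.homotopic_source by metis
next
  case (h1_tau y)
  then show ?case by (simp add: tau_walk_def tau_lift_eqI)
next
  case (h2 y z t)
  then have x: "f x = y" by (simp add: tau_walk_def)
  note z = tau_lift_props[OF h2(6) h2(2), unfolded x, OF h2(4)]
  have t: "Pcls E t = Pcls E (f (tau_lift z x))" using h2 z by simp
  note tt = tau_lift_props[OF z(3) h2(3) t]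
  have "tau_lift t x = tau_lift t (tau_lift z x)"
    by (rule tau_lift_eqI) (use h2 z tt in auto)
  then show ?case by (simp add: tau_walk_def)
next
  case (h3 a b)
  then have x: "f x = a" "x \<in> carrier E'" by (simp_all add: tau_walk_def)
  have b: "Pcls E b = Pcls E (f x)" using h3 x by simp
  note b' = tau_lift_props[OF x(2) h3(2) b]
  \<comment> \<open>By (f4) upstairs the right-hand point lies in the P-class of
    \<open>nakayama G g E' x\<close>, and it lies over \<open>nakayama G g E b\<close>.\<close>
  have "tau_lift (nakayama G g E b) (nakayama G g E' x) = nakayama G g E' (tau_lift b x)"
    by (rule tau_lift_eqI) (use b' x total.f4 f_nakayama in auto)
  then show ?case
    using lift_power_walk_deg[OF x(2,1)] lift_power_walk_deg[OF b'(3,2)]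
    by (simp add: tau_walk_def lift_walk_comp)
next
  case (h4 a b)
  then have x: "f x = a" "x \<in> carrier E'" by (simp_all add: tau_walk_def base.power_walk_1)
  have b: "Pcls E b = Pcls E (f x)" using h4 x base.Lcls_eq_imp_Pcls_eq by metis
  note b' = tau_lift_props[OF x(2) h4(2) b]
  \<comment> \<open>(f2) upstairs requires \<open>tau_lift b x\<close> in the L-class of
    \<open>x\<close>. Bijectivity on L-classes gives a point \<open>z\<close> over \<open>b\<close>
    there, and uniqueness of \<open>Tau\<close> lifts identifies the two.\<close>
  have "b \<in> f ` Lcls E' x"
    using bij_Lcls[OF x(2)] base.Lcls_mem_iff[of a b] h4 x by (simp add: bij_betw_def)
  then obtain z where z: "z \<in> Lcls E' x" "f z = b" by blast
  then have z': "z \<in> carrier E'" "Lcls E' z = Lcls E' x"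
    using total.Lcls_mem_iff[OF x(2)] by simp_all
  have "tau_lift b x = z"
    using tau_lift_eqI[OF x(2) z'(1)] total.Lcls_eq_imp_Pcls_eq[OF z'(1) x(2) z'(2)] z(2) by blast
  then have "Pcls E' (act E' g (tau_lift b x)) = Pcls E' (act E' g x)"
    using total.f2[OF z'(1) x(2) z'(2)] by simp
  then have "tau_lift (act E g b) (act E' g x) = act E' g (tau_lift b x)"
    using b' x(2) by (intro tau_lift_eqI) (auto simp: f_act)
  then show ?case by (simp add: tau_walk_def base.power_walk_1)
next
  case (h5_right u w v)
  then show ?case using lift_props by (simp add: lift_walk_comp)
qed (auto simp: lift_walk_comp)

text \<open>Each letter can be undone upstairs: \<open>g\<close> acts invertibly, and a
  \<open>Tau\<close> lift stays in a P-class, where points are determined by their images in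
  \<open>E\<close>.\<close>

lemma lift_inj:
  assumes "base.walk w" "x \<in> carrier E'" "f x = source w" "y \<in> carrier E'" "f y = source w"
    "lift x w = lift y w"
  shows "x = y"
  using assms
proof (induction w)
  case (Step z \<delta> w)
  have x: "lift x w \<in> carrier E'" "f (lift x w) = terminal w"
    and y: "lift y w \<in> carrier E'" "f (lift y w) = terminal w"
    using lift_props Step.prems by auto
  have "lift x w = lift y w"
  proof (cases \<delta>)
    case Fwd
    then show ?thesis using Step.prems x y total.act_inv_cancel(1)[OF base.g_closed] by (metis letter.simps(7) lift.simps(2))
  next
    case Bwd
    then show ?thesis using Step.prems x y total.act_inv_cancel(2)[OF base.g_closed] by (metis letter.simps(8) lift.simps(2))
  next
    case Tau
    then have z: "z \<in> carrier E" "Pcls E z = Pcls E (f (lift x w))" "Pcls E z = Pcls E (f (lift y w))"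
      and eq: "tau_lift z (lift x w) = tau_lift z (lift y w)"
      using Step.prems x y by simp_all
    \<comment> \<open>The common \<open>Tau\<close> lift lies in both P-classes. Then both
      \<open>lift x w\<close> and \<open>lift y w\<close> are the \<open>Tau\<close> lift of
      \<open>terminal w\<close> from \<open>lift x w\<close>.\<close>
    have "Pcls E' (lift y w) = Pcls E' (lift x w)"
      using tau_lift_props(4)[OF x(1) z(1,2)] tau_lift_props(4)[OF y(1) z(1,3)] eq by simp
    from tau_lift_eqI[OF x(1) y(1) this y(2)] show ?thesis
      using tau_lift_eqI[OF x(1) x(1) HOL.refl x(2)] by simp
  qed
  then show ?case using Step by simp
qed simp

text \<open>The walk is traced backwards from \<open>y\<close>: the last letter is undone first, a
  \<open>Tau\<close> step by the \<open>Tau\<close> lift back to \<open>terminal w\<close>.\<close>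

lemma lift_surj:
  assumes "base.walk w" "y \<in> carrier E'" "f y = terminal w"
  shows "\<exists>x\<in>carrier E'. f x = source w \<and> lift x w = y"
  using assms
proof (induction w arbitrary: y)
  case (Step z \<delta> w)
  have tw: "terminal w \<in> carrier E" using Step.prems base.terminal_walk by auto
  \<comment> \<open>The point \<open>u\<close> is where the lift must be before its last letter. The
    start \<open>x\<close> stays universally quantified, since only the induction hypothesis at
    \<open>u\<close> provides it.\<close>
  have "\<exists>u\<in>carrier E'. f u = terminal w \<and>
    (\<forall>x. lift x w = u \<longrightarrow> lift x (Step z \<delta> w) = y)"
  proof (cases \<delta>)
    case Fwd
    then show ?thesis using Step.prems tw by (intro bexI[of _ "act E' (inv\<^bsub>G\<^esub> g) y"]) (auto simp: f_act)
  next
    case Bwd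
    then show ?thesis using Step.prems tw by (intro bexI[of _ "act E' g y"]) (auto simp: f_act)
  next
    case Tau
    then have "Pcls E (terminal w) = Pcls E (f y)" using Step.prems by simp
    note u = tau_lift_props[OF Step.prems(2) tw this]
    then show ?thesis using Step.prems Tau
      by (intro bexI[of _ "tau_lift (terminal w) y"]) (auto intro!: tau_lift_eqI)
  qed
  then obtain u where u: "u \<in> carrier E'" "f u = terminal w"
    "\<And>x. lift x w = u \<Longrightarrow> lift x (Step z \<delta> w) = y" by blast
  then obtain x where "x \<in> carrier E'" "f x = source w" "lift x w = u"
    using Step.IH[of u] Step.prems by auto
  then show ?case using u(3) by auto
qed auto

section \<open>Coverings out of the universal cover\<close>

lemma cover_proj_cls:
  "base.walk w \<Longrightarrow> source w = e \<Longrightarrow> cover_proj G g E e (base.cls w) = terminal w"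
  using base.cls_in_uc_carrier by (auto simp: cover_proj_def)

text \<open>Letters \<open>Fwd\<close> and \<open>Bwd\<close> follow from equivariance. For
  \<open>Tau\<close>, the image stays in the P-class of the previous image and lies over
  \<open>y\<close> by \<open>proj\<close>, so it is the \<open>Tau\<close> lift. Hence the value at
  the trivial walk determines \<phi>.\<close>

lemma morphism_cls_eq_lift:
  assumes \<phi>: "fbc_morphism G g (base.ucov e) E' \<phi>"
    and proj: "cover_proj G g E e = compose (carrier (base.ucov e)) f \<phi>"
    and "base.walk w" and "source w = e"
  shows "\<phi> (base.cls w) = lift (\<phi> (base.cls (Triv e))) w"
  using assms(3,4)
proof (induction w)
  case (Step y \<delta> w)
  let ?W = "base.cls w" and ?V = "base.cls (Step y \<delta> w)"
  have w: "base.walk w" "source w = e" using Step.prems by simp_all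
  have W: "?W \<in> uc_carrier G g E e" and V: "?V \<in> uc_carrier G g E e"
    using base.cls_in_uc_carrier[OF w(1)] base.cls_in_uc_carrier[OF Step.prems(1)] w(2) by simp_all
  have \<phi>W: "\<phi> ?W \<in> carrier E'" and \<phi>V: "\<phi> ?V \<in> carrier E'"
    using \<phi> W V by (auto simp: fbc_morphism_def)
  have equi: "\<phi> (uc_act G g E e a ?W) = act E' a (\<phi> ?W)" if "a \<in> carrier G" for a
    using \<phi> W that by (simp add: fbc_morphism_def)
  have IH: "\<phi> ?W = lift (\<phi> (base.cls (Triv e))) w" using Step.IH w by simp
  show ?case
  proof (cases \<delta>)
    case Fwd
    then have "?V = base.cls (base.pw 1 w)"
      using Step.prems by (simp add: base.pw_def base.power_walk_1)
    also have "\<dots> = uc_act G g E e g ?W"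
      using base.uc_act_cls[OF w, of 1] by (simp add: base.int_pow_1)
    finally show ?thesis using equi[of g] IH Fwd by simp
  next
    case Bwd
    then have "?V = base.cls (base.pw (-1) w)"
      using Step.prems by (simp add: base.pw_def power_walk_def)
    also have "\<dots> = uc_act G g E e (inv\<^bsub>G\<^esub> g) ?W"
      using base.uc_act_cls[OF w, of "-1"] by (simp add: base.int_pow_neg base.int_pow_1)
    finally show ?thesis using equi[of "inv\<^bsub>G\<^esub> g"] IH Bwd by simp
  next
    case Tau
    then have "y \<in> Pcls E (terminal w)"
      using Step.prems base.Pcls_mem_iff base.terminal_walk by fastforce
    then have "?V \<in> Pcls (base.ucov e) ?W"
      unfolding base.Pcls_ucov[OF W] base.tau_block_cls[OF base.refines_Pcls w(1)] using Tau by blast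
    then have "\<phi> ?V \<in> Pcls E' (\<phi> ?W)"
      using \<phi> W unfolding fbc_morphism_def base.carrier_ucov by blast
    moreover have "f (\<phi> ?V) = y"
      using cover_proj_cls[OF Step.prems] fun_cong[OF proj, of ?V] V by (simp add: compose_eq)
    ultimately have "tau_lift y (\<phi> ?W) = \<phi> ?V"
      using tau_lift_eqI[OF \<phi>W \<phi>V] total.Pcls_mem_iff[OF \<phi>W] by simp
    then show ?thesis using IH Tau by simp
  qed
qed simp

section \<open>Existence: the map determined by a point over \<open>e\<close>\<close>

definition cover_lift :: "'a \<Rightarrow> 'b \<Rightarrow> 'a walk set \<Rightarrow> 'b" where
  "cover_lift e x = (\<lambda>W\<in>uc_carrier G g E e. lift x (rep W))"

text \<open>Independence of the representative is the homotopy invariance of lifts.\<close>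

lemma cover_lift_cls:
  assumes "base.walk w" "source w = e" "x \<in> carrier E'" "f x = e"
  shows "cover_lift e x (base.cls w) = lift x w"
  using lift_homotopic[OF base.rep_cls[OF assms(1)] assms(3)] base.cls_in_uc_carrier[OF assms(1)] assms
  by (simp add: cover_lift_def)

lemma f_cover_lift_cls:
  assumes "base.walk w" "source w = e" "x \<in> carrier E'" "f x = e"
  shows "cover_lift e x (base.cls w) \<in> carrier E'" and "f (cover_lift e x (base.cls w)) = terminal w"
  using lift_props[OF assms(1,3)] cover_lift_cls[OF assms] assms by simp_all

lemma cover_proj_eq_compose:
  assumes "x \<in> carrier E'" "f x = e"
  shows "cover_proj G g E e = compose (carrier (base.ucov e)) f (cover_lift e x)"
proof (rule extensionalityI[of _ "carrier (base.ucov e)"])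
  show "cover_proj G g E e W = compose (carrier (base.ucov e)) f (cover_lift e x) W"
    if "W \<in> carrier (base.ucov e)" for W
    using that unfolding base.carrier_ucov
    by (rule base.uc_carrierE)
      (use that assms in \<open>simp add: compose_eq cover_proj_cls f_cover_lift_cls\<close>)
qed (simp_all add: cover_proj_def)

text \<open>The composite of \<open>cover_lift e x\<close> with the bijection \<open>f\<close> on \<open>B\<close> is the covering projection of
  the universal cover, which is bijective on the block.\<close>

lemma bij_betw_cover_lift:
  assumes x: "x \<in> carrier E'" "f x = e" and w: "base.walk w" "source w = e"
    and K: "base.refines_P K" and bij: "bij_betw f B (K (terminal w))"
    and sub: "cover_lift e x ` base.tau_block K (base.cls w) \<subseteq> B"
  shows "bij_betw (cover_lift e x) (base.tau_block K (base.cls w)) B"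
proof -
  let ?T = "base.tau_block K (base.cls w)" and ?\<phi> = "cover_lift e x"
  have W: "base.cls w \<in> uc_carrier G g E e" using base.cls_in_uc_carrier w by blast
  have "terminal (rep V) = (f \<circ> ?\<phi>) V" if "V \<in> ?T" for V
  proof -
    have "V \<in> uc_carrier G g E e" using base.tau_block_subset[OF K W] that by blast
    then show ?thesis
      by (rule base.uc_carrierE) (use x in \<open>simp add: f_cover_lift_cls\<close>)
  qed
  then have comp: "bij_betw (f \<circ> ?\<phi>) ?T (K (terminal w))"
    using base.bij_betw_tau_block[OF K w(1)] by (simp cong: bij_betw_cong)
  have "inj_on ?\<phi> ?T" using comp inj_on_imageI2 by (auto simp: bij_betw_def)
  \<comment> \<open>\<open>f\<close> is injective on \<open>B\<close>, which contains the left side,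
    and maps both sides onto \<open>K (terminal w)\<close>.\<close>
  moreover have "?\<phi> ` ?T = B"
  proof (rule inj_on_Un_image_eq_iff[THEN iffD1])
    show "inj_on f (?\<phi> ` ?T \<union> B)" using bij sub by (simp add: bij_betw_def Un_absorb1)
    show "f ` ?\<phi> ` ?T = f ` B" using bij comp by (simp add: bij_betw_def image_comp)
  qed
  ultimately show ?thesis by (simp add: bij_betw_def)
qed

text \<open>For P this is the choice of \<open>tau_lift\<close>. For L, a point over
  \<open>h\<close> is taken in the L-class by bijectivity there; uniqueness in the larger P-class
  shows that it is the \<open>Tau\<close> lift.\<close>

lemma cover_lift_tau_block:
  assumes x: "x \<in> carrier E'" "f x = e" and w: "base.walk w" "source w = e"
  shows "cover_lift e x ` base.tau_block (Pcls E) (base.cls w) \<subseteq> Pcls E' (cover_lift e x (base.cls w))"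
    and "cover_lift e x ` base.tau_block (Lcls E) (base.cls w) \<subseteq> Lcls E' (cover_lift e x (base.cls w))"
proof -
  let ?u = "lift x w"
  have u: "?u \<in> carrier E'" "f ?u = terminal w" using lift_props w x by auto
  have t: "terminal w \<in> carrier E" using w(1) by (rule base.terminal_walk)
  have step: "cover_lift e x (base.cls (Step h Tau w)) = tau_lift h ?u" if "h \<in> Pcls E (terminal w)" for h
    using cover_lift_cls[OF base.walk_Step_tau[OF base.refines_Pcls w(1) that]] w x by simp
  show "cover_lift e x ` base.tau_block (Pcls E) (base.cls w) \<subseteq> Pcls E' (cover_lift e x (base.cls w))"
    unfolding base.tau_block_cls[OF base.refines_Pcls w(1)] cover_lift_cls[OF w x]
    using step tau_lift_props(1)[OF u(1)] u(2) base.Pcls_mem_iff[OF t] by auto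
  have "tau_lift h ?u \<in> Lcls E' ?u" if h: "h \<in> Lcls E (terminal w)" for h
  proof -
    have "h \<in> f ` Lcls E' ?u" using bij_Lcls[OF u(1)] h u(2) by (simp add: bij_betw_def)
    then obtain z where z: "z \<in> Lcls E' ?u" "f z = h" by blast
    then have "z \<in> carrier E'" "Pcls E' z = Pcls E' ?u"
      using total.Lcls_mem_iff[OF u(1)] total.Lcls_eq_imp_Pcls_eq[OF _ u(1)] by auto
    then show ?thesis using tau_lift_eqI[OF u(1)] z by simp
  qed
  then show "cover_lift e x ` base.tau_block (Lcls E) (base.cls w) \<subseteq> Lcls E' (cover_lift e x (base.cls w))"
    unfolding base.tau_block_cls[OF base.refines_Lcls w(1)] cover_lift_cls[OF w x]
    using step base.f1[OF t] by auto
qed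

lemma covering_cover_lift:
  assumes x: "x \<in> carrier E'" "f x = e"
  shows "fbc_covering G g (base.ucov e) E' (cover_lift e x)"
proof -
  let ?\<phi> = "cover_lift e x"
  have act: "?\<phi> (uc_act G g E e a W) = act E' a (?\<phi> W)"
    if a: "a \<in> carrier G" and W: "W \<in> uc_carrier G g E e" for a W
    using W
  proof (rule base.uc_carrierE)
    fix w assume w: "base.walk w" "source w = e" "W = base.cls w"
    obtain n :: int where n: "a = g [^]\<^bsub>G\<^esub> n" using base.carrier_power[OF a] by blast
    have "?\<phi> (base.cls (base.pw n w)) = lift x (base.pw n w)"
      using cover_lift_cls base.walk_pw w x by simp
    \<comment> \<open>The lift of \<open>pw n w\<close> first follows \<open>w\<close> and then the
      power walk, which acts by the same power of \<open>g\<close> upstairs.\<close>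
    also have "\<dots> = act E' (g [^]\<^bsub>G\<^esub> n) (lift x w)"
      using lift_props[OF w(1) x(1)] w(2) x(2) by (simp add: base.pw_def lift_walk_comp lift_power_walk)
    finally show ?thesis using w x n by (simp add: base.uc_act_cls cover_lift_cls)
  qed
  have "?\<phi> W \<in> carrier E' \<and> deg E' (?\<phi> W) = deg (base.ucov e) W \<and>
      ?\<phi> ` Pcls (base.ucov e) W \<subseteq> Pcls E' (?\<phi> W) \<and> ?\<phi> ` Lcls (base.ucov e) W \<subseteq> Lcls E' (?\<phi> W) \<and>
      bij_betw ?\<phi> (Pcls (base.ucov e) W) (Pcls E' (?\<phi> W)) \<and>
      bij_betw ?\<phi> (Lcls (base.ucov e) W) (Lcls E' (?\<phi> W))"
    if W: "W \<in> uc_carrier G g E e" for W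
    using W
  proof (rule base.uc_carrierE)
    fix w assume w: "base.walk w" "source w = e" "W = base.cls w"
    note \<phi>W = f_cover_lift_cls[OF w(1,2) x, folded w(3)]
    note sub = cover_lift_tau_block[OF x w(1,2), folded w(3)]
    \<comment> \<open>Both degrees equal that of \<open>terminal w\<close>, since \<open>f\<close>
      preserves degrees.\<close>
    have "deg E' (?\<phi> W) = deg (base.ucov e) W"
      using f_deg[OF \<phi>W(1)] \<phi>W(2) w by (simp add: base.deg_ucov)
    moreover have "bij_betw ?\<phi> (base.tau_block (Pcls E) W) (Pcls E' (?\<phi> W))"
      using bij_betw_cover_lift[OF x w(1,2) base.refines_Pcls, folded w(3), OF _ sub(1)]
        bij_Pcls[OF \<phi>W(1)] \<phi>W(2) by simp
    moreover have "bij_betw ?\<phi> (base.tau_block (Lcls E) W) (Lcls E' (?\<phi> W))"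
      using bij_betw_cover_lift[OF x w(1,2) base.refines_Lcls, folded w(3), OF _ sub(2)]
        bij_Lcls[OF \<phi>W(1)] \<phi>W(2) by simp
    ultimately show ?thesis using \<phi>W(1) sub by (simp add: base.Pcls_ucov[OF W] base.Lcls_ucov[OF W])
  qed
  moreover have "?\<phi> \<in> extensional (uc_carrier G g E e)" by (simp add: cover_lift_def)
  ultimately show ?thesis
    using act base.fbc_ucov total.fbc
    by (auto simp: fbc_covering_def fbc_morphism_def PiE_def)
qed

end

theorem proposition1p2:
  fixes G :: "('g, 'm) monoid_scheme" and g :: 'g
    and E :: "('g, 'a) fbc_data" and E' :: "('g, 'b) fbc_data"
    and e :: 'a and f :: "'b \<Rightarrow> 'a" and W :: "'a walk set" and e' :: 'b
  assumes "infinite_cyclic_group G g"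
    and "fbc G g E"
    and "e \<in> carrier E"
    and "fbc_covering G g E' E f"
    and "W \<in> carrier (univ_cover G g E e)"
    and "e' \<in> carrier E'"
    and "cover_proj G g E e W = f e'"
  shows "\<exists>!\<phi>. fbc_covering G g (univ_cover G g E e) E' \<phi> \<and> \<phi> W = e' \<and>
           cover_proj G g E e = compose (carrier (univ_cover G g E e)) f \<phi>"
proof -
  interpret frac_brauer_covering G g E E' f
    using assms(1,2,4)
    by unfold_locales (auto simp: fbc_covering_def fbc_morphism_def)
  have "W \<in> uc_carrier G g E e" using assms(5) by simp
  then obtain w where w: "base.walk w" "source w = e" "W = base.cls w" by (rule base.uc_carrierE)
  have "f e' = terminal w" using assms(7) cover_proj_cls w by simp
  then obtain x where x: "x \<in> carrier E'" "f x = e" "lift x w = e'"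
    using lift_surj[OF w(1) assms(6)] w(2) by auto
  have eq: "\<phi> = cover_lift e x"
    if \<phi>: "fbc_covering G g (base.ucov e) E' \<phi>" "\<phi> W = e'"
      "cover_proj G g E e = compose (carrier (base.ucov e)) f \<phi>" for \<phi>
  proof -
    have mor: "fbc_morphism G g (base.ucov e) E' \<phi>" using \<phi>(1) by (simp add: fbc_covering_def)
    note lift = morphism_cls_eq_lift[OF mor \<phi>(3)]
    have triv: "base.walk (Triv e)" "source (Triv e) = e" using assms(3) by simp_all
    have in_uc: "base.cls (Triv e) \<in> uc_carrier G g E e" using base.cls_in_uc_carrier[OF triv(1)] by simp
    let ?y = "\<phi> (base.cls (Triv e))"
    have y: "?y \<in> carrier E'" using mor in_uc by (auto simp: fbc_morphism_def)
    have "f ?y = e"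
      using cover_proj_cls[OF triv] fun_cong[OF \<phi>(3), of "base.cls (Triv e)"] in_uc by (simp add: compose_eq)
    \<comment> \<open>Both lifts of \<open>w\<close> end at \<open>e'\<close>, so
      \<open>lift_inj\<close> forces the starting points \<open>?y\<close> and \<open>x\<close> over
      \<open>e\<close> to agree.\<close>
    moreover have "lift ?y w = lift x w" using lift[OF w(1,2)] \<phi>(2) w(3) x(3) by simp
    ultimately have "?y = x" using lift_inj[OF w(1) y _ x(1)] x(2) w(2) by simp
    show ?thesis
    proof (rule extensionalityI[of _ "uc_carrier G g E e"])
      show "\<phi> \<in> extensional (uc_carrier G g E e)" using mor by (auto simp: fbc_morphism_def PiE_def)
      show "cover_lift e x \<in> extensional (uc_carrier G g E e)" by (simp add: cover_lift_def)
      show "\<phi> V = cover_lift e x V" if "V \<in> uc_carrier G g E e" for V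
        using that
        by (rule base.uc_carrierE) (use lift \<open>?y = x\<close> x in \<open>simp add: cover_lift_cls\<close>)
    qed
  qed
  show ?thesis
  proof (rule ex1I[of _ "cover_lift e x"])
    show "fbc_covering G g (base.ucov e) E' (cover_lift e x) \<and> cover_lift e x W = e' \<and>
        cover_proj G g E e = compose (carrier (base.ucov e)) f (cover_lift e x)"
      using covering_cover_lift[OF x(1,2)] cover_lift_cls[OF w(1,2) x(1,2)] w(3) x(3)
        cover_proj_eq_compose[OF x(1,2)] by simp
  qed (use eq in blast)
qed

end
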